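(* Let $X_1,X_2,\dots$ be an i.i.d. source with $X_t\sim P_X$ on an alphabet $\mathcal{X}$, let $\mathcal{Y}$ be a reproduction alphabet, let $d:\mathcal{X}\times\mathcal{Y}\to[0,\infty)$ be a (measurable) per-letter distortion measure, and let $d(x^n,y^n)=\frac1n\sum_{t=1}^n d(x_t,y_t)$. Let $(R,D)$ satisfy $R>R(D)$, where $R(D)=\inf\{I(X;Y): \mathbb{E}[d(X,Y)]\le D\}$, the infimum being over conditional distributions $P_{Y|X}$ with $(X,Y)\sim P_XP_{Y|X}$. Let $\mathcal{T}$ be the set of conditional distributions $\overline{P}_{Y|X}$ such that, with $\overline{P}_{XY}=P_X\overline{P}_{Y|X}$, one has $\mathbb{E}_{\overline{P}}[d(X,Y)]<D$ and $I_{\overline{P}}(X;Y)<R$. For $\overline{P}_{Y|X}\in\mathcal{T}$ and a positive integer $n$, let $\mathbb{E}_{\mathcal{C}^{(n)}}\big[\mathbb{P}_{\mathbf{P}}[d(X^n,Y^n)>D]\big]$ be the probability of excess distortion, averaged over the random codebook, of the rate-$R$, blocklength-$n$ scheme that uses the likelihood encoder and the codeword lookup decoder derived from $\overline{P}_{XY}$ (defined in the context). Then for every $n$, $$\inf_{\overline{P}_{Y|X}\in\mathcal{T}}\ \mathbb{E}_{\mathcal{C}^{(n)}}\big[\mathbb{P}_{\mathbf{P}}[d(X^n,Y^n)>D]\big]\ \le\ \inf_{\overline{P}_{Y|X}\in\mathcal{T}}\ \frac52\exp\Big(-n\min\big\{\eta(\overline{P}_{Y|X}),\gamma(\overline{P}_{Y|X})\big\}\Big),$$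 where $$\eta(\overline{P}_{Y|X})=\log\Big(\inf_{\beta>0}\mathbb{E}_{\overline{P}}\big[2^{\beta(d(X,Y)-D)}\big]\Big)^{-1},$$ $$\gamma(\overline{P}_{Y|X})=\sup_{\alpha\ge1,\ \alpha'\le2}\frac{\alpha-1}{2\alpha-\alpha'}\Big(R-\check{I}_{\overline{P},\alpha}(X;Y)+(\alpha'-1)\big(\check{I}_{\overline{P},\alpha}(X;Y)-\bar{I}_{\overline{P},\alpha'}(X;Y)\big)\Big),$$ with $\check{I}_{\overline{P},\alpha}$ and $\bar{I}_{\overline{P},\alpha'}$ as defined in the context.
   Context: Conventions. $\log$ and $\exp$ are to base $2$, i.e. $\exp(x)=2^x$; mutual information is in bits. $2^{nR}$ is treated as an integer (rounded up if necessary). If the infimum over $\beta$ in the definition of $\eta$ is $0$, then $\eta=+\infty$. An infimum over the empty set is $+\infty$. Density ratio. For $\overline{P}_{Y|X}$ with $\overline{P}_{XY}=P_X\overline{P}_{Y|X}$ and marginals $\overline{P}_X=P_X$, $\overline{P}_Y$, write $\rho(x,y)=\frac{\overline{P}_{XY}(x,y)}{\overline{P}_X(x)\overline{P}_Y(y)}$ (a ratio of probability mass functions for discrete alphabets, and in general a real-valued version of the Radon–Nikodym derivative of $\overline{P}_{XY}$ with respect to $\overline{P}_X\times\overline{P}_Y$, which exists when $I_{\overline{P}}(X;Y)<\infty$). The scheme. - Random codebook $\mathcal{C}^{(n)}$: sequences $Y^n(1),\dots,Y^n(2^{nR})$ drawn independently, each according to $\prod_{t=1}^n\overline{P}_Y$,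 independently of the source. - Likelihood encoder: upon observing $x^n$, the encoder picks the index $M=m$ at random with probability $$\mathbf{P}_{M|X^n}(m|x^n)=\frac{\mathcal{L}(m|x^n)}{\sum_{m'=1}^{2^{nR}}\mathcal{L}(m'|x^n)},\qquad \mathcal{L}(m|x^n)=\prod_{t=1}^n\overline{P}_{X|Y}(x_t|Y_t(m)).$$ Equivalently, one may use $\prod_{t=1}^n\rho(x_t,Y_t(m))$ in place of $\mathcal{L}(m|x^n)$. If the denominator is $0$, the encoder uses an arbitrary fixed distribution on the indices. - Decoder: outputs $Y^n=Y^n(M)$. $\mathbf{P}$ denotes the resulting joint distribution of $(X^n,M,Y^n)$ for a given codebook, with $X^n\sim\prod_{t=1}^n P_X$; it is random through the codebook. $\mathbb{E}_{\mathcal{C}^{(n)}}$ is expectation over the random codebook. Information quantities. For $\alpha>1$, $$\check{I}_{\overline{P},\alpha}(X;Y)=\frac{1}{\alpha-1}\log\Big(\mathbb{E}_{\overline{P}}\big[\rho(X,Y)^{\alpha-1}\big]\Big),$$ and $\check{I}_{\overline{P},1}(X;Y)=I_{\overline{P}}(X;Y)$. For $\alpha'\le2$, $\alpha'\neq1$, $$\bar{I}_{\overline{P},\alpha'}(X;Y)=\frac{1}{\alpha'-1}\log\Bigg(\bigg(\mathbb{E}_{\overline{P}_X}\bigg[\sqrt{\mathbb{E}_{\overline{P}_{Y|X}}\big[\rho(X,Y)^{\alpha'-1}\big]}\bigg]\bigg)^2\Bigg),$$ where the inner expectation is over $Y\sim\overline{P}_{Y|X}(\cdot|X)$ given $X$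 and the outer one over $X\sim\overline{P}_X$. At $\alpha'=1$ the product $(\alpha'-1)\bar{I}_{\overline{P},\alpha'}(X;Y)$ is read as $0$. The supremum defining $\gamma$ is over those pairs $(\alpha,\alpha')\ne(1,2)$ with $\alpha\ge1$, $\alpha'\le2$ for which the quantities involved are finite. *)

theory Defs
  imports "HOL-Probability.Probability"
begin

definition elog2 :: "ennreal \<Rightarrow> ereal" where
  "elog2 a = (if a = 0 then - \<infinity> else if a = \<infinity> then \<infinity> else ereal (log 2 (enn2real a)))"

definition eexp2 :: "ereal \<Rightarrow> ennreal" where
  "eexp2 a = (if a = \<infinity> then \<infinity> else if a = - \<infinity> then 0 else ennreal (2 powr real_of_ereal a))"

definition esqrt :: "ennreal \<Rightarrow> ennreal" where
  "esqrt a = (if a = \<infinity> then \<infinity> else ennreal (sqrt (enn2real a)))"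

text \<open>
  Throughout, \<open>P\<close> is the source distribution (a probability measure on the source alphabet
  \<open>space P\<close>), \<open>Y\<close> carries the measurable space of the reproduction alphabet (only its
  \<open>\<sigma>\<close>-algebra matters), and \<open>K\<close> is a conditional distribution of the reproduction symbol given
  the source symbol.
\<close>

definition channels :: "'x measure \<Rightarrow> 'y measure \<Rightarrow> ('x \<Rightarrow> 'y measure) set" where
  "channels P Y = P \<rightarrow>\<^sub>M prob_algebra Y"

definition joint_law :: "'x measure \<Rightarrow> 'y measure \<Rightarrow> ('x \<Rightarrow> 'y measure) \<Rightarrow> ('x \<times> 'y) measure" where
  "joint_law P Y K = P \<bind> (\<lambda>x. distr (K x) (P \<Otimes>\<^sub>M Y) (\<lambda>y. (x, y)))"

definition output_law :: "'x measure \<Rightarrow> 'y measure \<Rightarrow> ('x \<Rightarrow> 'y measure) \<Rightarrow> 'y measure" where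
  "output_law P Y K = distr (joint_law P Y K) Y snd"

definition product_law :: "'x measure \<Rightarrow> 'y measure \<Rightarrow> ('x \<Rightarrow> 'y measure) \<Rightarrow> ('x \<times> 'y) measure" where
  "product_law P Y K = P \<Otimes>\<^sub>M output_law P Y K"

definition density_ratio :: "'x measure \<Rightarrow> 'y measure \<Rightarrow> ('x \<Rightarrow> 'y measure) \<Rightarrow> 'x \<Rightarrow> 'y \<Rightarrow> real" where
  "density_ratio P Y K x y = enn2real (RN_deriv (product_law P Y K) (joint_law P Y K) (x, y))"

text \<open>
  Mutual information in bits, with values in \<open>[0, \<infinity>]\<close>.  The function \<^const>\<open>KL_divergence\<close> is a
  Bochner integral and returns a junk value if the joint law is not absolutely continuous with
  respect to the product law or if the integral diverges; in both situations the mutual information is infinite.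
\<close>

definition mutual_info :: "'x measure \<Rightarrow> 'y measure \<Rightarrow> ('x \<Rightarrow> 'y measure) \<Rightarrow> ereal" where
  "mutual_info P Y K =
    (if absolutely_continuous (product_law P Y K) (joint_law P Y K) \<and>
        integrable (joint_law P Y K) (entropy_density 2 (product_law P Y K) (joint_law P Y K))
     then ereal (KL_divergence 2 (product_law P Y K) (joint_law P Y K))
     else \<infinity>)"

definition expected_distortion ::
  "'x measure \<Rightarrow> 'y measure \<Rightarrow> ('x \<Rightarrow> 'y \<Rightarrow> real) \<Rightarrow> ('x \<Rightarrow> 'y measure) \<Rightarrow> ereal" where
  "expected_distortion P Y d K = enn2ereal (\<integral>\<^sup>+ (x, y). ennreal (d x y) \<partial>joint_law P Y K)"

definition rate_distortion ::
  "'x measure \<Rightarrow> 'y measure \<Rightarrow> ('x \<Rightarrow> 'y \<Rightarrow> real) \<Rightarrow> real \<Rightarrow> ereal" where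
  "rate_distortion P Y d D =
    (INF K \<in> {K \<in> channels P Y. expected_distortion P Y d K \<le> ereal D}. mutual_info P Y K)"

definition test_channels ::
  "'x measure \<Rightarrow> 'y measure \<Rightarrow> ('x \<Rightarrow> 'y \<Rightarrow> real) \<Rightarrow> real \<Rightarrow> real \<Rightarrow> ('x \<Rightarrow> 'y measure) set" where
  "test_channels P Y d R D =
    {K \<in> channels P Y. expected_distortion P Y d K < ereal D \<and> mutual_info P Y K < ereal R}"

text \<open>
  Blocks of length \<open>n\<close> are elements of \<open>Pi\<^sub>M {1..n} _\<close>, and a codebook \<open>c\<close> maps an index \<open>m\<close> to the
  block \<open>c m\<close>.
\<close>

definition codebook_size :: "nat \<Rightarrow> real \<Rightarrow> nat" where
  "codebook_size n R = nat \<lceil>2 powr (real n * R)\<rceil>"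

definition codebook_law ::
  "'x measure \<Rightarrow> 'y measure \<Rightarrow> ('x \<Rightarrow> 'y measure) \<Rightarrow> nat \<Rightarrow> real \<Rightarrow> (nat \<Rightarrow> nat \<Rightarrow> 'y) measure" where
  "codebook_law P Y K n R =
    Pi\<^sub>M {1..codebook_size n R} (\<lambda>_. Pi\<^sub>M {1..n} (\<lambda>_. output_law P Y K))"

text \<open>
  The likelihood is expressed through the density ratio, which makes sense for arbitrary alphabets.
  On discrete alphabets it differs from the product of the \<open>P(x\<^sub>t | y\<^sub>t)\<close> by the factor
  \<open>P(x\<^sub>1) \<cdots> P(x\<^sub>n)\<close>, which does not depend on the index and cancels in the encoder.
\<close>

definition likelihood ::
  "'x measure \<Rightarrow> 'y measure \<Rightarrow> ('x \<Rightarrow> 'y measure) \<Rightarrow> nat \<Rightarrow> (nat \<Rightarrow> nat \<Rightarrow> 'y) \<Rightarrow> (nat \<Rightarrow> 'x) \<Rightarrow> nat \<Rightarrow> real"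
where
  "likelihood P Y K n c x m = (\<Prod>t = 1..n. density_ratio P Y K (x t) (c m t))"

text \<open>
  The distribution \<open>q\<close> on the indices is the fallback of the encoder for the case that all
  likelihoods vanish.
\<close>

definition encoder_prob ::
  "'x measure \<Rightarrow> 'y measure \<Rightarrow> ('x \<Rightarrow> 'y measure) \<Rightarrow> nat \<Rightarrow> real \<Rightarrow> nat pmf
    \<Rightarrow> (nat \<Rightarrow> nat \<Rightarrow> 'y) \<Rightarrow> (nat \<Rightarrow> 'x) \<Rightarrow> nat \<Rightarrow> real"
where
  "encoder_prob P Y K n R q c x m =
    (let s = (\<Sum>m' = 1..codebook_size n R. likelihood P Y K n c x m')
     in if s = 0 then pmf q m else likelihood P Y K n c x m / s)"

definition encoder ::
  "'x measure \<Rightarrow> 'y measure \<Rightarrow> ('x \<Rightarrow> 'y measure) \<Rightarrow> nat \<Rightarrow> real \<Rightarrow> nat pmf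
    \<Rightarrow> (nat \<Rightarrow> nat \<Rightarrow> 'y) \<Rightarrow> (nat \<Rightarrow> 'x) \<Rightarrow> nat measure"
where
  "encoder P Y K n R q c x =
    point_measure {1..codebook_size n R} (\<lambda>m. ennreal (encoder_prob P Y K n R q c x m))"

text \<open>
  The joint law of source block, index and reproduction block for a given codebook \<open>c\<close>; the
  decoder looks up the codeword \<open>c m\<close>.
\<close>

definition scheme_law ::
  "'x measure \<Rightarrow> 'y measure \<Rightarrow> ('x \<Rightarrow> 'y measure) \<Rightarrow> nat \<Rightarrow> real \<Rightarrow> nat pmf
    \<Rightarrow> (nat \<Rightarrow> nat \<Rightarrow> 'y) \<Rightarrow> ((nat \<Rightarrow> 'x) \<times> nat \<times> (nat \<Rightarrow> 'y)) measure"
where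
  "scheme_law P Y K n R q c =
    Pi\<^sub>M {1..n} (\<lambda>_. P) \<bind>
      (\<lambda>x. distr (encoder P Y K n R q c x)
        (Pi\<^sub>M {1..n} (\<lambda>_. P) \<Otimes>\<^sub>M count_space {1..codebook_size n R} \<Otimes>\<^sub>M Pi\<^sub>M {1..n} (\<lambda>_. Y))
        (\<lambda>m. (x, m, c m)))"

definition block_distortion ::
  "('x \<Rightarrow> 'y \<Rightarrow> real) \<Rightarrow> nat \<Rightarrow> (nat \<Rightarrow> 'x) \<Rightarrow> (nat \<Rightarrow> 'y) \<Rightarrow> real" where
  "block_distortion d n x y = 1 / real n * (\<Sum>t = 1..n. d (x t) (y t))"

definition excess_prob ::
  "'x measure \<Rightarrow> 'y measure \<Rightarrow> ('x \<Rightarrow> 'y \<Rightarrow> real) \<Rightarrow> real \<Rightarrow> real \<Rightarrow> nat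
    \<Rightarrow> ('x \<Rightarrow> 'y measure) \<Rightarrow> nat pmf \<Rightarrow> (nat \<Rightarrow> nat \<Rightarrow> 'y) \<Rightarrow> ennreal"
where
  "excess_prob P Y d R D n K q c =
    emeasure (scheme_law P Y K n R q c)
      {(x, m, y) \<in> space (scheme_law P Y K n R q c). block_distortion d n x y > D}"

definition expected_excess_prob ::
  "'x measure \<Rightarrow> 'y measure \<Rightarrow> ('x \<Rightarrow> 'y \<Rightarrow> real) \<Rightarrow> real \<Rightarrow> real \<Rightarrow> nat
    \<Rightarrow> ('x \<Rightarrow> 'y measure) \<Rightarrow> nat pmf \<Rightarrow> ennreal"
where
  "expected_excess_prob P Y d R D n K q =
    (\<integral>\<^sup>+ c. excess_prob P Y d R D n K q c \<partial>codebook_law P Y K n R)"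

definition I_check :: "'x measure \<Rightarrow> 'y measure \<Rightarrow> ('x \<Rightarrow> 'y measure) \<Rightarrow> real \<Rightarrow> ereal" where
  "I_check P Y K \<alpha> =
    (if \<alpha> = 1 then mutual_info P Y K
     else ereal (1 / (\<alpha> - 1)) *
       elog2 (\<integral>\<^sup>+ (x, y). ennreal (density_ratio P Y K x y powr (\<alpha> - 1)) \<partial>joint_law P Y K))"

definition I_bar :: "'x measure \<Rightarrow> 'y measure \<Rightarrow> ('x \<Rightarrow> 'y measure) \<Rightarrow> real \<Rightarrow> ereal" where
  "I_bar P Y K \<alpha>' =
    ereal (1 / (\<alpha>' - 1)) *
      elog2 ((\<integral>\<^sup>+ x. esqrt (\<integral>\<^sup>+ y. ennreal (density_ratio P Y K x y powr (\<alpha>' - 1)) \<partial>K x) \<partial>P)\<^sup>2)"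

definition eta ::
  "'x measure \<Rightarrow> 'y measure \<Rightarrow> ('x \<Rightarrow> 'y \<Rightarrow> real) \<Rightarrow> real \<Rightarrow> ('x \<Rightarrow> 'y measure) \<Rightarrow> ereal" where
  "eta P Y d D K =
    elog2 (inverse (INF \<beta> \<in> {0<..}.
      \<integral>\<^sup>+ (x, y). ennreal (2 powr (\<beta> * (d x y - D))) \<partial>joint_law P Y K))"

text \<open>
  At \<open>\<alpha>' = 1\<close> the quantity \<open>I_bar\<close> is meaningless, and it enters \<open>gamma_term\<close> only through a product
  with the factor \<open>\<alpha>' - 1 = 0\<close>.
\<close>

definition gamma_domain ::
  "'x measure \<Rightarrow> 'y measure \<Rightarrow> ('x \<Rightarrow> 'y measure) \<Rightarrow> (real \<times> real) set" where
  "gamma_domain P Y K =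
    {(\<alpha>, \<alpha>'). \<alpha> \<ge> 1 \<and> \<alpha>' \<le> 2 \<and> (\<alpha>, \<alpha>') \<noteq> (1, 2) \<and>
       \<bar>I_check P Y K \<alpha>\<bar> \<noteq> \<infinity> \<and> (\<alpha>' = 1 \<or> \<bar>I_bar P Y K \<alpha>'\<bar> \<noteq> \<infinity>)}"

definition gamma_term ::
  "'x measure \<Rightarrow> 'y measure \<Rightarrow> real \<Rightarrow> ('x \<Rightarrow> 'y measure) \<Rightarrow> real \<Rightarrow> real \<Rightarrow> real" where
  "gamma_term P Y R K \<alpha> \<alpha>' =
    (\<alpha> - 1) / (2 * \<alpha> - \<alpha>') *
      (R - real_of_ereal (I_check P Y K \<alpha>)
         + (\<alpha>' - 1) * (real_of_ereal (I_check P Y K \<alpha>) - real_of_ereal (I_bar P Y K \<alpha>')))"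

definition gamma ::
  "'x measure \<Rightarrow> 'y measure \<Rightarrow> real \<Rightarrow> ('x \<Rightarrow> 'y measure) \<Rightarrow> ereal" where
  "gamma P Y R K = (SUP (\<alpha>, \<alpha>') \<in> gamma_domain P Y K. ereal (gamma_term P Y R K \<alpha> \<alpha>'))"

end

theory Submission
  imports Defs
begin

text \<open>
  Fix a test channel with density ratio \<open>\<rho>\<close> and output law \<open>W\<close>, let \<open>L\<close> be the product of the
  \<open>\<rho>(x\<^sub>t, y\<^sub>t)\<close> and let \<open>s\<close> be the sum of the \<open>N\<close> likelihoods \<open>L(x, c m)\<close>.  Since
  \<open>L/s = L/N + (L/s)(1 - s/N)\<close>, the excess probability given the codebook \<open>c\<close> and the source block \<open>x\<close> is
  at most the average over \<open>m\<close> of \<open>L(x, c m) 1{d(x, c m) > D}\<close> plus \<open>(1 - s/N)\<^sup>+\<close>.  The first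
  summand averages to the excess probability under the \<open>n\<close>-fold joint law, to which Chernoff's bound
  applies and gives \<open>\<eta>\<close>.  For the second one, the part of \<open>L\<close> above a threshold \<open>\<theta>\<close> is
  controlled by the moment of order \<open>\<alpha> - 1\<close> and the part below by its variance, hence by the
  moment of order \<open>\<alpha>' - 1\<close>; the threshold that balances the two gives \<open>\<gamma>\<close>.
\<close>

subsection \<open>Square roots in the extended reals and one-shot soft covering\<close>

lemma esqrt_ennreal: "0 \<le> x \<Longrightarrow> esqrt (ennreal x) = ennreal (sqrt x)"
  by (simp add: esqrt_def)

lemma esqrt_0 [simp]: "esqrt 0 = 0"
  using esqrt_ennreal[of 0] by simp

lemma esqrt_1 [simp]: "esqrt 1 = 1"
  using esqrt_ennreal[of 1] by simp

lemma esqrt_mono: "a \<le> b \<Longrightarrow> esqrt a \<le> esqrt b"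
  unfolding esqrt_def
  by (auto simp: top_unique less_top intro!: ennreal_leI enn2real_mono)

text \<open>Infinite factors are covered because 0 times infinity is 0 on both sides.
  Multiplicativity is what lets the square root of a block quantity split into square roots of
  letter quantities.\<close>

lemma esqrt_mult: "esqrt (a * b) = esqrt a * esqrt b"
proof (cases a; cases b)
  fix r s assume "a = ennreal r" "0 \<le> r" "b = ennreal s" "0 \<le> s"
  then show ?thesis
    by (simp add: esqrt_ennreal ennreal_mult[symmetric] real_sqrt_mult)
next
  fix r assume a: "a = ennreal r" "0 \<le> r" and b: "b = top"
  then show ?thesis
    by (cases "r = 0") (simp_all add: esqrt_def ennreal_mult_top ennreal_top_mult)
next
  fix r assume a: "b = ennreal r" "0 \<le> r" and b: "a = top"
  then show ?thesis
    by (cases "r = 0") (simp_all add: esqrt_def ennreal_mult_top ennreal_top_mult)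
qed (simp add: esqrt_def)

lemma esqrt_prod: "esqrt (\<Prod>i\<in>I. f i) = (\<Prod>i\<in>I. esqrt (f i))"
  by (induction I rule: infinite_finite_induct) (simp_all add: esqrt_mult)

lemma borel_measurable_esqrt [measurable]: "esqrt \<in> borel_measurable borel"
  unfolding esqrt_def by measurable

section \<open>Second moments of sums over independent codewords\<close>

context prob_space
begin

lemma nn_integral_PiM_component:
  assumes "g \<in> borel_measurable M" "i \<in> I"
  shows "(\<integral>\<^sup>+ c. g (c i) \<partial>Pi\<^sub>M I (\<lambda>_. M)) = integral\<^sup>N M g"
proof -
  have "integral\<^sup>N M g = integral\<^sup>N (distr (Pi\<^sub>M I (\<lambda>_. M)) M (\<lambda>c. c i)) g"
    using assms by (subst distr_PiM_component) (simp_all add: prob_space_axioms)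
  also have "\<dots> = (\<integral>\<^sup>+ c. g (c i) \<partial>Pi\<^sub>M I (\<lambda>_. M))"
    using assms by (subst nn_integral_distr) simp_all
  finally show ?thesis ..
qed

lemma
  fixes g :: "'a \<Rightarrow> real"
  assumes "integrable M g" "i \<in> I"
  shows integrable_PiM_component: "integrable (Pi\<^sub>M I (\<lambda>_. M)) (\<lambda>c. g (c i))"
    and integral_PiM_component: "(\<integral> c. g (c i) \<partial>Pi\<^sub>M I (\<lambda>_. M)) = integral\<^sup>L M g"
proof -
  have *: "distr (Pi\<^sub>M I (\<lambda>_. M)) M (\<lambda>c. c i) = M"
    using assms by (subst distr_PiM_component) (simp_all add: prob_space_axioms)
  show "integrable (Pi\<^sub>M I (\<lambda>_. M)) (\<lambda>c. g (c i))"
    using assms by (subst integrable_distr_eq[of "\<lambda>c. c i" _ M g, symmetric]) (simp_all add: *)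
  show "(\<integral> c. g (c i) \<partial>Pi\<^sub>M I (\<lambda>_. M)) = integral\<^sup>L M g"
    using assms by (subst integral_distr[of "\<lambda>c. c i" _ M g, symmetric]) (simp_all add: *)
qed

text \<open>The product of two coordinates is read as a product over all of \<open>I\<close> with
  the constant factor 1 elsewhere, so that Fubini for finite products gives independence.\<close>

lemma
  fixes Z :: "'a \<Rightarrow> real"
  assumes I: "finite I" "i \<in> I" "j \<in> I" "i \<noteq> j" and Z: "integrable M Z"
  shows integrable_PiM_component_mult:
      "integrable (Pi\<^sub>M I (\<lambda>_. M)) (\<lambda>c. Z (c i) * Z (c j))" (is ?int)
    and integral_PiM_component_mult:
      "(\<integral> c. Z (c i) * Z (c j) \<partial>Pi\<^sub>M I (\<lambda>_. M)) = (integral\<^sup>L M Z)\<^sup>2" (is ?eq)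
proof -
  interpret PS: product_sigma_finite "\<lambda>_::'b. M"
    by (intro product_sigma_finite.intro sigma_finite_measure_axioms)
  define h where "h k = (if k = i \<or> k = j then Z else (\<lambda>_. 1))" for k
  have split: "(\<Prod>k\<in>I. g k) = g i * g j"
    if "\<And>k. k \<noteq> i \<Longrightarrow> k \<noteq> j \<Longrightarrow> g k = 1" for g :: "'b \<Rightarrow> real"
  proof -
    have "(\<Prod>k\<in>I. g k) = (\<Prod>k\<in>{i, j}. g k)"
      using I that by (intro prod.mono_neutral_right) auto
    then show ?thesis using I by simp
  qed
  have prod: "(\<Prod>k\<in>I. h k (c k)) = Z (c i) * Z (c j)" for c :: "'b \<Rightarrow> 'a"
    using split[of "\<lambda>k. h k (c k)"] by (simp add: h_def)
  have h: "integrable M (h k)" for k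
    using Z by (simp add: h_def)
  show ?int
    using PS.product_integrable_prod[OF I(1), of h] h by (simp add: prod)
  have "(\<Prod>k\<in>I. integral\<^sup>L M (h k)) = (integral\<^sup>L M Z)\<^sup>2"
    using split[of "\<lambda>k. integral\<^sup>L M (h k)"] by (simp add: h_def prob_space power2_eq_square)
  then show ?eq
    using PS.product_integral_prod[OF I(1), of h] h by (simp add: prod)
qed

text \<open>After expanding the square, independence and mean zero remove the off-diagonal terms;
  only the \<open>card I\<close> diagonal ones survive.\<close>

lemma integral_PiM_sum_square:
  fixes Z :: "'a \<Rightarrow> real"
  assumes I: "finite I" and Z: "integrable M Z" "integrable M (\<lambda>y. (Z y)\<^sup>2)" "integral\<^sup>L M Z = 0"
  shows "(\<integral> c. (\<Sum>i\<in>I. Z (c i))\<^sup>2 \<partial>Pi\<^sub>M I (\<lambda>_. M)) = real (card I) * (\<integral> y. (Z y)\<^sup>2 \<partial>M)"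
proof -
  let ?P = "Pi\<^sub>M I (\<lambda>_. M)"
  have int: "integrable ?P (\<lambda>c. Z (c i) * Z (c j))" if "i \<in> I" "j \<in> I" for i j
    using that integrable_PiM_component_mult[of I i j Z] integrable_PiM_component[OF Z(2) that(1)]
      I Z(1) by (cases "i = j") (auto simp: power2_eq_square)
  have eq: "(\<integral> c. Z (c i) * Z (c j) \<partial>?P) = (if j = i then \<integral> y. (Z y)\<^sup>2 \<partial>M else 0)"
    if "i \<in> I" "j \<in> I" for i j
    using that integral_PiM_component_mult[of I i j Z] integral_PiM_component[OF Z(2) that(1)] I Z
    by (cases "i = j") (auto simp: power2_eq_square)
  have "(\<integral> c. (\<Sum>i\<in>I. Z (c i))\<^sup>2 \<partial>?P) = (\<integral> c. (\<Sum>i\<in>I. \<Sum>j\<in>I. Z (c i) * Z (c j)) \<partial>?P)"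
    by (simp add: power2_eq_square sum_product)
  also have "\<dots> = (\<Sum>i\<in>I. \<Sum>j\<in>I. \<integral> c. Z (c i) * Z (c j) \<partial>?P)"
    by (subst Bochner_Integration.integral_sum)
       (auto intro!: Bochner_Integration.integrable_sum int Bochner_Integration.integral_sum sum.cong)
  also have "\<dots> = (\<Sum>i\<in>I. \<Sum>j\<in>I. if j = i then \<integral> y. (Z y)\<^sup>2 \<partial>M else 0)"
    by (intro sum.cong refl eq)
  also have "\<dots> = real (card I) * (\<integral> y. (Z y)\<^sup>2 \<partial>M)"
    using I by simp
  finally show ?thesis .
qed

text \<open>This is nonnegativity of the variance of \<bar>V\<bar>.\<close>

lemma expectation_abs_le_sqrt:
  fixes V :: "'a \<Rightarrow> real"
  assumes "integrable M V" "integrable M (\<lambda>y. (V y)\<^sup>2)"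
  shows "expectation (\<lambda>y. \<bar>V y\<bar>) \<le> sqrt (expectation (\<lambda>y. (V y)\<^sup>2))"
proof -
  have "0 \<le> variance (\<lambda>y. \<bar>V y\<bar>)"
    by (rule variance_positive)
  also have "\<dots> = expectation (\<lambda>y. (V y)\<^sup>2) - (expectation (\<lambda>y. \<bar>V y\<bar>))\<^sup>2"
    using assms by (subst variance_eq) auto
  finally show ?thesis
    by (intro real_le_rsqrt) simp
qed

text \<open>
  The variance is only taken of the part of \<open>F\<close> below the threshold \<open>\<theta>\<close>.  The factor
  \<open>1/2\<close> is due to \<open>V\<^sup>+ = (V + \<bar>V\<bar>) / 2\<close> for the centred sum \<open>V\<close>.
\<close>

lemma soft_covering_one_shot:
  fixes F :: "'a \<Rightarrow> real" and N :: nat and \<theta> :: real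
  assumes F [measurable]: "F \<in> borel_measurable M" and F_nonneg: "\<And>y. 0 \<le> F y"
    and F_int: "(\<integral>\<^sup>+ y. ennreal (F y) \<partial>M) = 1" and N: "0 < N"
  shows "(\<integral>\<^sup>+ c. ennreal (max 0 (1 - (\<Sum>m = 1..N. F (c m)) / N)) \<partial>Pi\<^sub>M {1..N} (\<lambda>_. M))
    \<le> (\<integral>\<^sup>+ y. ennreal (if F y \<le> \<theta> then 0 else F y) \<partial>M)
      + ennreal (1 / 2) * esqrt (ennreal (1 / N) * (\<integral>\<^sup>+ y. ennreal (if F y \<le> \<theta> then (F y)\<^sup>2 else 0) \<partial>M))"
proof -
  define F1 where "F1 y = (if F y \<le> \<theta> then F y else 0)" for y
  define F2 where "F2 y = (if F y \<le> \<theta> then 0 else F y)" for y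
  define e1 where "e1 = expectation F1"
  define e2 where "e2 = expectation F2"
  define Z where "Z y = e1 - F1 y" for y
  let ?P = "Pi\<^sub>M {1..N} (\<lambda>_. M)"
  interpret Pr: prob_space ?P
    by (intro prob_space_PiM prob_space_axioms)
  have [measurable]: "F1 \<in> borel_measurable M" "F2 \<in> borel_measurable M" "Z \<in> borel_measurable M"
    unfolding F1_def F2_def Z_def by measurable
  have F1: "0 \<le> F1 y" "F1 y \<le> \<bar>\<theta>\<bar>" "F1 y \<le> F y" "F1 y + F2 y = F y" "0 \<le> F2 y" "F2 y \<le> F y" for y
    using F_nonneg[of y] by (auto simp: F1_def F2_def)
  have intF: "integrable M F" 
    using F_int F_nonneg by (intro integrableI_nonneg) auto
  have EF: "expectation F = 1"
    using F_int F_nonneg by (subst integral_eq_nn_integral) auto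
  have intF1: "integrable M F1" and intF2: "integrable M F2"
    using F1 F_nonneg by (auto intro!: Bochner_Integration.integrable_bound[OF intF])
  have "e1 + e2 = expectation (\<lambda>y. F1 y + F2 y)"
    unfolding e1_def e2_def using intF1 intF2 by simp
  then have e12: "e1 + e2 = 1"
    by (simp add: F1 EF)
  have intF1sq: "integrable M (\<lambda>y. (F1 y)\<^sup>2)"
    using F1 by (intro integrable_const_bound[where B = "\<theta>\<^sup>2"])
      (auto intro!: AE_I2 simp: abs_le_square_iff[symmetric])
  have intZ: "integrable M Z"
    unfolding Z_def using intF1 by simp
  have Z0: "expectation Z = 0"
    unfolding Z_def using intF1 by (simp add: prob_space e1_def)
  have Zsq: "(Z y)\<^sup>2 = e1\<^sup>2 + (F1 y)\<^sup>2 - 2 * e1 * F1 y" for y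
    unfolding Z_def by (rule power2_diff)
  have intZsq: "integrable M (\<lambda>y. (Z y)\<^sup>2)"
    unfolding Zsq using intF1 intF1sq by simp
  \<comment> \<open>A variance is at most the second moment. The truncation makes \<open>F1\<close>
    bounded, so the second moment is finite even when that of \<open>F\<close> is not.\<close>
  have EZsq: "expectation (\<lambda>y. (Z y)\<^sup>2) \<le> expectation (\<lambda>y. (F1 y)\<^sup>2)"
    unfolding Zsq using intF1 intF1sq by (simp add: prob_space e1_def[symmetric] power2_eq_square)
  define V where "V c = (\<Sum>m = 1..N. Z (c m)) / N" for c :: "nat \<Rightarrow> 'a"
  have [measurable]: "V \<in> borel_measurable ?P"
    unfolding V_def by measurable
  have V: "V c = e1 - (\<Sum>m = 1..N. F1 (c m)) / N" for c
    using N by (simp add: V_def Z_def sum_subtractf field_simps)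
  have intV: "integrable ?P V"
    unfolding V_def by (intro integrable_divide Bochner_Integration.integrable_sum integrable_PiM_component intZ)
  have intVabs: "integrable ?P (\<lambda>c. (V c + \<bar>V c\<bar>) / 2)"
    by (intro integrable_divide Bochner_Integration.integrable_add integrable_abs intV)
  have EV: "integral\<^sup>L ?P V = 0"
  proof -
    have "integral\<^sup>L ?P V = (\<Sum>m = 1..N. \<integral>c. Z (c m) \<partial>?P) / N"
      unfolding V_def
      by (simp add: Bochner_Integration.integral_sum integrable_PiM_component[OF intZ])
    also have "(\<Sum>m = 1..N. \<integral>c. Z (c m) \<partial>?P) = 0"
      by (intro sum.neutral ballI) (simp add: integral_PiM_component[OF intZ] Z0)
    finally show ?thesis by simp
  qed
  have Vsq: "(V c)\<^sup>2 = (\<Sum>m = 1..N. Z (c m))\<^sup>2 / N\<^sup>2" for c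
    by (simp add: V_def power_divide)
  have EVsq: "(\<integral>c. (V c)\<^sup>2 \<partial>?P) = 1 / N * expectation (\<lambda>y. (Z y)\<^sup>2)"
    unfolding Vsq using integral_PiM_sum_square[of "{1..N}" Z] intZ intZsq Z0 N
    by (simp add: power2_eq_square[of N])
  have intVsq: "integrable ?P (\<lambda>c. (V c)\<^sup>2)"
  proof (rule Pr.integrable_const_bound[where B = "(\<bar>e1\<bar> + \<bar>\<theta>\<bar>)\<^sup>2"])
    have "\<bar>V c\<bar> \<le> \<bar>\<bar>e1\<bar> + \<bar>\<theta>\<bar>\<bar>" for c
    proof -
      have "\<bar>\<Sum>m = 1..N. Z (c m)\<bar> \<le> (\<Sum>m = 1..N. \<bar>e1\<bar> + \<bar>\<theta>\<bar>)"
        unfolding Z_def using F1(1,2) 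
        by (intro order_trans[OF sum_abs] sum_mono) (smt (verit) F1(1,2))
      then show ?thesis
        using N by (simp add: V_def field_simps)
    qed
    then show "AE c in ?P. norm ((V c)\<^sup>2) \<le> (\<bar>e1\<bar> + \<bar>\<theta>\<bar>)\<^sup>2"
      by (intro AE_I2) (simp add: abs_le_square_iff[symmetric])
  qed measurable
  \<comment> \<open>Dropping the part above the threshold only lowers the empirical mean, and 1 = e1
    + e2. Hence the shortfall is at most the lost mass \<open>e2\<close> plus the positive part of
    \<open>V\<close>.\<close>
  have le: "max 0 (1 - (\<Sum>m = 1..N. F (c m)) / N) \<le> e2 + (V c + \<bar>V c\<bar>) / 2" for c
  proof -
    have "(\<Sum>m = 1..N. F1 (c m)) / N \<le> (\<Sum>m = 1..N. F (c m)) / N"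
      by (intro divide_right_mono sum_mono F1) simp
    moreover have "0 \<le> e2"
      unfolding e2_def by (intro Bochner_Integration.integral_nonneg F1)
    moreover have "max 0 (1 - s) \<le> e2 + (v + \<bar>v\<bar>) / 2"
      if "s1 \<le> s" "0 \<le> e2" "v = e1 - s1" for s s1 v
      using that e12 by (auto simp: max_def abs_if field_simps)
    ultimately show ?thesis
      using V by blast
  qed
  have "(\<integral>\<^sup>+ c. ennreal (max 0 (1 - (\<Sum>m = 1..N. F (c m)) / N)) \<partial>?P)
      \<le> (\<integral>\<^sup>+ c. ennreal (e2 + (V c + \<bar>V c\<bar>) / 2) \<partial>?P)"
    by (intro nn_integral_mono ennreal_leI le)
  also have "\<dots> = ennreal (\<integral> c. e2 + (V c + \<bar>V c\<bar>) / 2 \<partial>?P)"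
  proof (rule nn_integral_eq_integral)
    show "AE c in ?P. 0 \<le> e2 + (V c + \<bar>V c\<bar>) / 2"
      using le by (intro AE_I2) (smt (verit) max.cobounded1)
    show "integrable ?P (\<lambda>c. e2 + (V c + \<bar>V c\<bar>) / 2)"
      by (intro Bochner_Integration.integrable_add Pr.integrable_const intVabs)
  qed
  \<comment> \<open>The linear term disappears because \<open>V\<close> has mean zero.\<close>
  also have "(\<integral> c. e2 + (V c + \<bar>V c\<bar>) / 2 \<partial>?P) = e2 + (\<integral> c. \<bar>V c\<bar> \<partial>?P) / 2"
    by (subst Bochner_Integration.integral_add[OF Pr.integrable_const intVabs], subst integral_divide_zero,
        subst Bochner_Integration.integral_add[OF intV integrable_abs[OF intV]])
       (simp add: Pr.prob_space EV del: One_nat_def)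
  also have "ennreal \<dots> \<le> ennreal (e2 + sqrt (1 / N * expectation (\<lambda>y. (F1 y)\<^sup>2)) / 2)"
  proof (intro ennreal_leI add_left_mono divide_right_mono)
    have "(\<integral> c. \<bar>V c\<bar> \<partial>?P) \<le> sqrt (\<integral>c. (V c)\<^sup>2 \<partial>?P)"
      by (rule Pr.expectation_abs_le_sqrt[OF intV intVsq])
    also have "\<dots> \<le> sqrt (1 / N * expectation (\<lambda>y. (F1 y)\<^sup>2))"
      unfolding EVsq using EZsq by (intro real_sqrt_le_mono mult_left_mono) auto
    finally show "(\<integral> c. \<bar>V c\<bar> \<partial>?P) \<le> sqrt (1 / N * expectation (\<lambda>y. (F1 y)\<^sup>2))" .
  qed simp
  also have "\<dots> = ennreal e2 + ennreal (1 / 2) * esqrt (ennreal (1 / N) * ennreal (expectation (\<lambda>y. (F1 y)\<^sup>2)))"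
  proof -
    have "0 \<le> e2" "0 \<le> expectation (\<lambda>y. (F1 y)\<^sup>2)"
      unfolding e2_def by (intro Bochner_Integration.integral_nonneg F1) simp
    have "ennreal (u + sqrt (r * w) / 2) = ennreal u + ennreal (1 / 2) * esqrt (ennreal r * ennreal w)"
      if "0 \<le> u" "0 \<le> w" "0 \<le> r" for u r w
    proof -
      have "ennreal (1 / 2) * esqrt (ennreal r * ennreal w) = ennreal (1 / 2) * ennreal (sqrt (r * w))"
        using that by (simp only: ennreal_mult[symmetric] esqrt_ennreal mult_nonneg_nonneg)
      also have "\<dots> = ennreal (1 / 2 * sqrt (r * w))"
        using that by (intro ennreal_mult[symmetric]) simp_all
      finally show ?thesis
        using that by (subst ennreal_plus) simp_all
    qed
    from this[of e2 "expectation (\<lambda>y. (F1 y)\<^sup>2)" "1 / real N"] show ?thesis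
      using \<open>0 \<le> e2\<close> by simp
  qed
  also have "ennreal e2 = (\<integral>\<^sup>+ y. ennreal (F2 y) \<partial>M)"
    unfolding e2_def using F1 by (intro nn_integral_eq_integral[symmetric] intF2) auto
  also have "ennreal (expectation (\<lambda>y. (F1 y)\<^sup>2)) = (\<integral>\<^sup>+ y. ennreal ((F1 y)\<^sup>2) \<partial>M)"
    by (intro nn_integral_eq_integral[symmetric] intF1sq) auto
  finally show ?thesis
    by (simp add: F1_def F2_def if_distrib[of "\<lambda>x. x\<^sup>2"] cong: if_cong)
qed

end

subsection \<open>Soft covering for blocks\<close>

text \<open>Above the threshold the factor \<open>(F / \<theta>) powr a\<close> is at least 1. The
  form \<open>F * F powr a\<close> keeps one factor \<open>F\<close> as a density, so that the rest
  becomes a moment under the joint law.\<close>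

lemma truncated_tail_le:
  fixes F \<theta> a :: real
  assumes "0 \<le> F" "0 < \<theta>" "0 \<le> a"
  shows "(if F \<le> \<theta> then 0 else F) \<le> \<theta> powr (- a) * (F * F powr a)"
proof (cases "F \<le> \<theta>")
  case False
  then have "\<theta> powr a \<le> F powr a"
    using assms by (intro powr_mono2) auto
  then have "F * 1 \<le> F * (\<theta> powr (- a) * F powr a)"
    using assms by (intro mult_left_mono) (auto simp: powr_minus field_simps)
  then show ?thesis
    using False by (simp add: mult.left_commute)
qed (use assms in simp)

text \<open>For 0 < F \<le> \<theta> one factor of the square is split as
  \<open>F powr (1 - b) * F powr b\<close>, and the first of these is monotone since 1 - b \<ge> 0.
  The exponent \<open>b\<close> itself may be negative.\<close>

lemma truncated_square_le:
  fixes F \<theta> b :: real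
  assumes "0 \<le> F" "0 < \<theta>" "b \<le> 1"
  shows "(if F \<le> \<theta> then F\<^sup>2 else 0) \<le> \<theta> powr (1 - b) * (F * F powr b)"
proof (cases "F \<le> \<theta> \<and> F \<noteq> 0")
  case True
  then have "F powr (1 - b) \<le> \<theta> powr (1 - b)"
    using assms by (intro powr_mono2) auto
  moreover have "F powr (1 - b) * F powr b = F"
    using True assms by (simp add: powr_add[symmetric])
  ultimately have "F \<le> \<theta> powr (1 - b) * F powr b"
    by (metis mult_right_mono powr_ge_zero)
  then have "F * F \<le> F * (\<theta> powr (1 - b) * F powr b)"
    using assms by (intro mult_left_mono) auto
  then show ?thesis
    using True by (simp add: power2_eq_square mult.left_commute)
qed (use assms in auto)

lemma (in prob_space) product_sigma_finite_const: "product_sigma_finite (\<lambda>_. M)"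
  by (intro product_sigma_finite.intro sigma_finite_measure_axioms)

text \<open>An abstract conditional density \<open>f\<close> with respect to an output law
  \<open>W\<close>. Normalisation is demanded only almost everywhere, as a Radon-Nikodym derivative
  offers no more.\<close>

locale block_likelihood = P: prob_space P + W: prob_space W
  for P :: "'x measure" and W :: "'y measure" +
  fixes f :: "'x \<Rightarrow> 'y \<Rightarrow> real" and n :: nat
  assumes f_meas: "case_prod f \<in> borel_measurable (P \<Otimes>\<^sub>M W)"
    and f_nonneg: "\<And>x y. 0 \<le> f x y"
    and f_int: "AE x in P. (\<integral>\<^sup>+ y. ennreal (f x y) \<partial>W) = 1"
begin

abbreviation Pn where "Pn \<equiv> Pi\<^sub>M {1..n} (\<lambda>_. P)"
abbreviation Wn where "Wn \<equiv> Pi\<^sub>M {1..n} (\<lambda>_. W)"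

definition L :: "(nat \<Rightarrow> 'x) \<Rightarrow> (nat \<Rightarrow> 'y) \<Rightarrow> real" where
  "L x y = (\<Prod>t = 1..n. f (x t) (y t))"

sublocale Pn: prob_space Pn
  by (intro prob_space_PiM P.prob_space_axioms)

sublocale Wn: prob_space Wn
  by (intro prob_space_PiM W.prob_space_axioms)

lemma measurable_f [measurable (raw)]:
  assumes "g \<in> M \<rightarrow>\<^sub>M P" "h \<in> M \<rightarrow>\<^sub>M W"
  shows "(\<lambda>z. f (g z) (h z)) \<in> borel_measurable M"
  using measurable_compose[OF measurable_Pair[OF assms] f_meas] by simp

lemma measurable_L [measurable (raw)]:
  assumes [measurable]: "g \<in> M \<rightarrow>\<^sub>M Pn" "h \<in> M \<rightarrow>\<^sub>M Wn"
  shows "(\<lambda>z. L (g z) (h z)) \<in> borel_measurable M"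
  unfolding L_def
proof (intro borel_measurable_prod measurable_f)
  fix t assume t: "t \<in> {1..n}"
  show "(\<lambda>z. g z t) \<in> M \<rightarrow>\<^sub>M P" "(\<lambda>z. h z t) \<in> M \<rightarrow>\<^sub>M W"
    using measurable_compose[OF assms(1) measurable_component_singleton[OF t]]
      measurable_compose[OF assms(2) measurable_component_singleton[OF t]] by auto
qed

lemma L_nonneg: "0 \<le> L x y"
  unfolding L_def by (intro prod_nonneg ballI f_nonneg)

lemma nn_integral_Wn_prod:
  assumes x: "x \<in> space Pn"
    and g: "case_prod g \<in> borel_measurable (P \<Otimes>\<^sub>M W)"
  shows "(\<integral>\<^sup>+ y. (\<Prod>t = 1..n. g (x t) (y t)) \<partial>Wn) = (\<Prod>t = 1..n. \<integral>\<^sup>+ y. g (x t) y \<partial>W)"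
proof -
  interpret W: product_sigma_finite "\<lambda>_::nat. W"
    by (rule W.product_sigma_finite_const)
  show ?thesis
  proof (rule W.product_nn_integral_prod)
    fix t assume t: "t \<in> {1..n}"
    have "x t \<in> space P"
      using x t by (auto simp: space_PiM)
    then show "g (x t) \<in> borel_measurable W"
      using measurable_compose[OF measurable_Pair1' g] by simp
  qed simp
qed

lemma nn_integral_Pn_prod:
  assumes g: "g \<in> borel_measurable P"
  shows "(\<integral>\<^sup>+ x. (\<Prod>t = 1..n. g (x t)) \<partial>Pn) = (integral\<^sup>N P g) ^ n"
proof -
  interpret P: product_sigma_finite "\<lambda>_::nat. P"
    by (rule P.product_sigma_finite_const)
  show ?thesis
    using P.product_nn_integral_prod[of "{1..n}" "\<lambda>_. g"] g by simp
qed

lemma L_powr: "ennreal (L x y * L x y powr a) = (\<Prod>t = 1..n. ennreal (f (x t) (y t) * f (x t) (y t) powr a))"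
proof -
  have "L x y powr a = (\<Prod>t = 1..n. f (x t) (y t) powr a)"
    unfolding L_def by (rule prod_powr_distrib)
  then have "L x y * L x y powr a = (\<Prod>t = 1..n. f (x t) (y t) * f (x t) (y t) powr a)"
    by (simp only: L_def prod.distrib)
  then show ?thesis
    by (simp only: prod_ennreal f_nonneg mult_nonneg_nonneg powr_ge_zero)
qed

text \<open>The letterwise null sets are finitely many, so almost every block avoids all of them;
  then the integral factorises.\<close>

lemma nn_integral_L_eq_1: "AE x in Pn. (\<integral>\<^sup>+ y. ennreal (L x y) \<partial>Wn) = 1"
proof -
  have "AE x in Pn. \<forall>t\<in>{1..n}. (\<integral>\<^sup>+ y. ennreal (f (x t) y) \<partial>W) = 1"
    using f_int by (intro AE_finite_allI AE_PiM_component P.prob_space_axioms) simp_all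
  then show ?thesis
    using AE_space
  proof eventually_elim
    case (elim x)
    have "(\<integral>\<^sup>+ y. ennreal (L x y) \<partial>Wn) = (\<integral>\<^sup>+ y. (\<Prod>t = 1..n. ennreal (f (x t) (y t))) \<partial>Wn)"
      by (simp add: L_def prod_ennreal f_nonneg)
    also have "\<dots> = (\<Prod>t = 1..n. \<integral>\<^sup>+ y. ennreal (f (x t) y) \<partial>W)"
      using elim by (intro nn_integral_Wn_prod[where g = "\<lambda>x y. ennreal (f x y)"]) simp_all
    finally show ?case
      using elim by simp
  qed
qed

text \<open>For almost every source block the one-shot bound applies with \<open>F = L x\<close>.
  The truncated parts are replaced by moments, which factor over the letters and turn into n-th
  powers. The threshold and both exponents stay free for the later optimisation.\<close>

lemma soft_covering:
  fixes N :: nat and \<theta> a b :: real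
  assumes N: "0 < N" and \<theta>: "0 < \<theta>" and a: "0 \<le> a" and b: "b \<le> 1"
  shows "(\<integral>\<^sup>+ x. \<integral>\<^sup>+ c. ennreal (max 0 (1 - (\<Sum>m = 1..N. L x (c m)) / N)) \<partial>Pi\<^sub>M {1..N} (\<lambda>_. Wn) \<partial>Pn)
    \<le> ennreal (\<theta> powr (- a)) * (\<integral>\<^sup>+ x. \<integral>\<^sup>+ y. ennreal (f x y * f x y powr a) \<partial>W \<partial>P) ^ n
      + ennreal (sqrt (\<theta> powr (1 - b) / N) / 2)
        * (\<integral>\<^sup>+ x. esqrt (\<integral>\<^sup>+ y. ennreal (f x y * f x y powr b) \<partial>W) \<partial>P) ^ n"
    (is "?I \<le> _")
proof -
  define u where "u e x = (\<integral>\<^sup>+ y. ennreal (f x y * f x y powr e) \<partial>W)" for e x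
  have [measurable]: "u e \<in> borel_measurable P" for e
    unfolding u_def by measurable
  have tensor: "(\<integral>\<^sup>+ y. ennreal (L x y * L x y powr e) \<partial>Wn) = (\<Prod>t = 1..n. u e (x t))"
    if "x \<in> space Pn" for x e
    unfolding L_powr u_def using that
    by (intro nn_integral_Wn_prod[where g = "\<lambda>x y. ennreal (f x y * f x y powr e)"]) measurable
  have "AE x in Pn. (\<integral>\<^sup>+ c. ennreal (max 0 (1 - (\<Sum>m = 1..N. L x (c m)) / N)) \<partial>Pi\<^sub>M {1..N} (\<lambda>_. Wn))
    \<le> ennreal (\<theta> powr (- a)) * (\<Prod>t = 1..n. u a (x t))
      + ennreal (sqrt (\<theta> powr (1 - b) / N) / 2) * (\<Prod>t = 1..n. esqrt (u b (x t)))"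
    using nn_integral_L_eq_1 AE_space
  proof eventually_elim
    case (elim x)
    note [measurable] = elim(2)
    have meas [measurable]: "L x \<in> borel_measurable Wn"
      by measurable
    have "(\<integral>\<^sup>+ y. ennreal (if L x y \<le> \<theta> then 0 else L x y) \<partial>Wn)
        \<le> (\<integral>\<^sup>+ y. ennreal (\<theta> powr (- a)) * ennreal (L x y * L x y powr a) \<partial>Wn)"
      using \<theta> a
      by (intro nn_integral_mono, subst ennreal_mult[symmetric])
         (simp_all only: L_nonneg powr_ge_zero mult_nonneg_nonneg ennreal_leI truncated_tail_le)
    also have "\<dots> = ennreal (\<theta> powr (- a)) * (\<Prod>t = 1..n. u a (x t))"
      by (subst nn_integral_cmult) (measurable, simp add: tensor elim del: One_nat_def)
    finally have 1: "(\<integral>\<^sup>+ y. ennreal (if L x y \<le> \<theta> then 0 else L x y) \<partial>Wn)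
        \<le> ennreal (\<theta> powr (- a)) * (\<Prod>t = 1..n. u a (x t))" .
    have "(\<integral>\<^sup>+ y. ennreal (if L x y \<le> \<theta> then (L x y)\<^sup>2 else 0) \<partial>Wn)
        \<le> (\<integral>\<^sup>+ y. ennreal (\<theta> powr (1 - b)) * ennreal (L x y * L x y powr b) \<partial>Wn)"
      using \<theta> b
      by (intro nn_integral_mono, subst ennreal_mult[symmetric])
         (simp_all only: L_nonneg powr_ge_zero mult_nonneg_nonneg ennreal_leI truncated_square_le)
    also have "\<dots> = ennreal (\<theta> powr (1 - b)) * (\<Prod>t = 1..n. u b (x t))"
      by (subst nn_integral_cmult) (measurable, simp add: tensor elim del: One_nat_def)
    finally have "ennreal (1 / N) * (\<integral>\<^sup>+ y. ennreal (if L x y \<le> \<theta> then (L x y)\<^sup>2 else 0) \<partial>Wn)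
        \<le> ennreal (1 / N) * (ennreal (\<theta> powr (1 - b)) * (\<Prod>t = 1..n. u b (x t)))"
      by (rule mult_left_mono) simp
    also have "\<dots> = ennreal (\<theta> powr (1 - b) / N) * (\<Prod>t = 1..n. u b (x t))"
      by (simp add: mult.assoc[symmetric] ennreal_mult[symmetric])
    \<comment> \<open>The variance bound is conditional on the source block, so the root is taken
      before averaging over \<open>x\<close>. This is the origin of the root inside the outer
      expectation of \<open>I_bar\<close>.\<close>
    finally have "esqrt (ennreal (1 / N) * (\<integral>\<^sup>+ y. ennreal (if L x y \<le> \<theta> then (L x y)\<^sup>2 else 0) \<partial>Wn))
        \<le> esqrt (ennreal (\<theta> powr (1 - b) / N) * (\<Prod>t = 1..n. u b (x t)))"
      by (rule esqrt_mono)
    also have "\<dots> = ennreal (sqrt (\<theta> powr (1 - b) / N)) * (\<Prod>t = 1..n. esqrt (u b (x t)))"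
      by (simp only: esqrt_mult esqrt_prod esqrt_ennreal divide_nonneg_nonneg powr_ge_zero of_nat_0_le_iff)
    finally have "ennreal (1 / 2) * esqrt (ennreal (1 / N) * (\<integral>\<^sup>+ y. ennreal (if L x y \<le> \<theta> then (L x y)\<^sup>2 else 0) \<partial>Wn))
        \<le> ennreal (1 / 2) * (ennreal (sqrt (\<theta> powr (1 - b) / N)) * (\<Prod>t = 1..n. esqrt (u b (x t))))"
      by (rule mult_left_mono) simp
    also have "\<dots> = ennreal (sqrt (\<theta> powr (1 - b) / N) / 2) * (\<Prod>t = 1..n. esqrt (u b (x t)))"
      using ennreal_mult[of "1 / 2" "sqrt (\<theta> powr (1 - b) / N)"] by (simp add: mult.assoc)
    finally show ?case
      using 1 by (intro order_trans[OF Wn.soft_covering_one_shot[OF meas L_nonneg elim(1) N]] add_mono)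
  qed
  then have "?I \<le> (\<integral>\<^sup>+ x. ennreal (\<theta> powr (- a)) * (\<Prod>t = 1..n. u a (x t))
      + ennreal (sqrt (\<theta> powr (1 - b) / N) / 2) * (\<Prod>t = 1..n. esqrt (u b (x t))) \<partial>Pn)"
    by (rule nn_integral_mono_AE)
  also have "\<dots> = ennreal (\<theta> powr (- a)) * (integral\<^sup>N P (u a)) ^ n
      + ennreal (sqrt (\<theta> powr (1 - b) / N) / 2) * (\<integral>\<^sup>+ x. esqrt (u b x) \<partial>P) ^ n"
  proof -
    have [measurable]: "(\<lambda>x. \<Prod>t = 1..n. g (x t)) \<in> borel_measurable Pn"
      if [measurable]: "g \<in> borel_measurable P" for g :: "'x \<Rightarrow> ennreal"
      by (intro borel_measurable_prod_ennreal) measurable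
    show ?thesis
      using nn_integral_Pn_prod[of "u a"] nn_integral_Pn_prod[of "\<lambda>x. esqrt (u b x)"]
      by (simp add: nn_integral_add nn_integral_cmult del: One_nat_def)
  qed
  finally show ?thesis
    unfolding u_def .
qed

end

subsection \<open>Densities of channels\<close>

text \<open>Absolute continuity is what finite mutual information provides for a test channel; it
  makes \<open>density_ratio\<close> a genuine density of the joint law.\<close>

locale source_channel = P: prob_space P
  for P :: "'x measure" and Y :: "'y measure" and K :: "'x \<Rightarrow> 'y measure" +
  assumes K_channel: "K \<in> channels P Y"
    and abs_cont: "absolutely_continuous (product_law P Y K) (joint_law P Y K)"
begin

abbreviation W where "W \<equiv> output_law P Y K"

lemma measurable_K [measurable]: "K \<in> P \<rightarrow>\<^sub>M subprob_algebra Y"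
  using K_channel unfolding channels_def by (rule measurable_prob_algebraD)

lemma K_prob: "x \<in> space P \<Longrightarrow> prob_space (K x)"
  and sets_K: "x \<in> space P \<Longrightarrow> sets (K x) = sets Y"
  using measurable_space[OF K_channel[unfolded channels_def]] by (auto simp: space_prob_algebra)

lemma joint_kernel: "(\<lambda>x. distr (K x) (P \<Otimes>\<^sub>M Y) (\<lambda>y. (x, y))) \<in> P \<rightarrow>\<^sub>M subprob_algebra (P \<Otimes>\<^sub>M Y)"
  by (rule measurable_distr2[OF _ measurable_K]) simp

lemma sets_joint [measurable_cong, simp]: "sets (joint_law P Y K) = sets (P \<Otimes>\<^sub>M Y)"
  unfolding joint_law_def by (rule sets_bind) (simp_all add: P.not_empty)

lemma nn_integral_joint:
  assumes h: "h \<in> borel_measurable (P \<Otimes>\<^sub>M Y)"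
  shows "integral\<^sup>N (joint_law P Y K) h = (\<integral>\<^sup>+ x. \<integral>\<^sup>+ y. h (x, y) \<partial>K x \<partial>P)"
proof -
  have "integral\<^sup>N (joint_law P Y K) h
      = (\<integral>\<^sup>+ x. integral\<^sup>N (distr (K x) (P \<Otimes>\<^sub>M Y) (\<lambda>y. (x, y))) h \<partial>P)"
    unfolding joint_law_def by (rule nn_integral_bind[OF h joint_kernel])
  also have "\<dots> = (\<integral>\<^sup>+ x. \<integral>\<^sup>+ y. h (x, y) \<partial>K x \<partial>P)"
  proof (intro nn_integral_cong, subst nn_integral_distr)
    fix x assume x: "x \<in> space P"
    show "h \<in> borel_measurable (distr (K x) (P \<Otimes>\<^sub>M Y) (Pair x))"
      using h by simp
    from x show "(\<lambda>y. (x, y)) \<in> K x \<rightarrow>\<^sub>M P \<Otimes>\<^sub>M Y"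
      by (subst measurable_cong_sets[OF sets_K refl]) simp_all
  qed simp
  finally show ?thesis .
qed

lemma prob_space_joint: "prob_space (joint_law P Y K)"
proof
  have "emeasure (joint_law P Y K) (space (joint_law P Y K)) = (\<integral>\<^sup>+ z. 1 \<partial>joint_law P Y K)"
    by simp
  also have "\<dots> = (\<integral>\<^sup>+ x. emeasure (K x) (space (K x)) \<partial>P)"
    by (subst nn_integral_joint) simp_all
  also have "\<dots> = (\<integral>\<^sup>+ x. 1 \<partial>P)"
    by (intro nn_integral_cong prob_space.emeasure_space_1 K_prob)
  finally show "emeasure (joint_law P Y K) (space (joint_law P Y K)) = 1"
    by (simp add: P.emeasure_space_1)
qed

lemma sets_W [measurable_cong, simp]: "sets W = sets Y"
  unfolding output_law_def by simp

lemma space_W [simp]: "space W = space Y"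
  by (rule sets_eq_imp_space_eq) simp

sublocale W: prob_space W
  unfolding output_law_def
  by (rule prob_space.prob_space_distr[OF prob_space_joint]) measurable

sublocale PW: pair_prob_space P W ..

lemma sets_product [measurable_cong, simp]: "sets (product_law P Y K) = sets (P \<Otimes>\<^sub>M Y)"
  unfolding product_law_def by (intro sets_pair_measure_cong) simp_all

lemma sets_PW [simp]: "sets (P \<Otimes>\<^sub>M W) = sets (P \<Otimes>\<^sub>M Y)"
  by (intro sets_pair_measure_cong) simp_all

lemma borel_measurable_PW: "borel_measurable (P \<Otimes>\<^sub>M W) = borel_measurable (P \<Otimes>\<^sub>M Y)"
  by (intro measurable_cong_sets) simp_all

abbreviation \<rho> where "\<rho> \<equiv> density_ratio P Y K"

lemma measurable_density_ratio: "case_prod \<rho> \<in> borel_measurable (P \<Otimes>\<^sub>M W)"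
proof -
  have "RN_deriv (P \<Otimes>\<^sub>M W) (joint_law P Y K) \<in> borel_measurable (P \<Otimes>\<^sub>M W)"
    by (rule borel_measurable_RN_deriv)
  then show ?thesis
    unfolding density_ratio_def case_prod_unfold product_law_def by simp
qed

lemma density_ratio_nonneg: "0 \<le> \<rho> x y"
  by (simp add: density_ratio_def)

text \<open>Change of measure from the joint law to the product of its marginals, followed by
  Tonelli. The derivative is almost everywhere finite, so its real-valued version loses
  nothing.\<close>

lemma nn_integral_joint_density:
  assumes h: "h \<in> borel_measurable (P \<Otimes>\<^sub>M Y)"
  shows "integral\<^sup>N (joint_law P Y K) h = (\<integral>\<^sup>+ x. \<integral>\<^sup>+ y. ennreal (\<rho> x y) * h (x, y) \<partial>W \<partial>P)"
proof -
  have h' [measurable]: "h \<in> borel_measurable (P \<Otimes>\<^sub>M W)"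
    using h by (simp add: borel_measurable_PW)
  note measurable_density_ratio[measurable]
  have ac: "absolutely_continuous (P \<Otimes>\<^sub>M W) (joint_law P Y K)"
    using abs_cont by (simp add: product_law_def)
  have fin: "AE z in P \<Otimes>\<^sub>M W. RN_deriv (P \<Otimes>\<^sub>M W) (joint_law P Y K) z \<noteq> \<infinity>"
    using prob_space_imp_sigma_finite[OF prob_space_joint] ac
    by (intro PW.RN_deriv_finite) simp_all
  have "integral\<^sup>N (joint_law P Y K) h
      = (\<integral>\<^sup>+ z. RN_deriv (P \<Otimes>\<^sub>M W) (joint_law P Y K) z * h z \<partial>(P \<Otimes>\<^sub>M W))"
    by (rule PW.RN_deriv_nn_integral[OF ac _ h']) simp
  also have "\<dots> = (\<integral>\<^sup>+ z. ennreal (case_prod \<rho> z) * h z \<partial>(P \<Otimes>\<^sub>M W))"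
    using fin by (intro nn_integral_cong_AE, eventually_elim)
      (auto simp: density_ratio_def product_law_def less_top split: prod.split)
  also have "\<dots> = (\<integral>\<^sup>+ x. \<integral>\<^sup>+ y. ennreal (case_prod \<rho> (x, y)) * h (x, y) \<partial>W \<partial>P)"
    by (rule W.nn_integral_fst[symmetric]) measurable
  finally show ?thesis
    by simp
qed

text \<open>The conditional form of the change of measure, needed because \<open>I_bar\<close> has a
  square root between the two integrals. Both sides are densities with respect to \<open>P\<close>,
  and they are identified by integrating \<open>h\<close> times the indicator of an arbitrary source
  event in both ways.\<close>

lemma nn_integral_K_density:
  assumes h: "h \<in> borel_measurable (P \<Otimes>\<^sub>M Y)"
  shows "AE x in P. (\<integral>\<^sup>+ y. h (x, y) \<partial>K x) = (\<integral>\<^sup>+ y. ennreal (\<rho> x y) * h (x, y) \<partial>W)"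
proof (rule P.density_unique)
  note h[measurable]
  have h' [measurable]: "h \<in> borel_measurable (P \<Otimes>\<^sub>M W)"
    using h by (simp add: borel_measurable_PW)
  note measurable_density_ratio[measurable]
  let ?u = "\<lambda>x. \<integral>\<^sup>+ y. h (x, y) \<partial>K x"
  let ?v = "\<lambda>x. \<integral>\<^sup>+ y. ennreal (\<rho> x y) * h (x, y) \<partial>W"
  show u [measurable]: "?u \<in> borel_measurable P"
    by (rule nn_integral_measurable_subprob_algebra2[OF _ measurable_K]) simp
  have "(\<lambda>x. \<integral>\<^sup>+ y. ennreal (case_prod \<rho> (x, y)) * h (x, y) \<partial>W) \<in> borel_measurable P"
    by measurable
  then show v [measurable]: "?v \<in> borel_measurable P"
    by simp
  show "density P ?u = density P ?v"
  proof (rule measure_eqI)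
    fix A assume "A \<in> sets (density P ?u)"
    then have A [measurable]: "A \<in> sets P" by simp
    let ?h = "\<lambda>z. h z * indicator A (fst z)"
    have h'': "?h \<in> borel_measurable (P \<Otimes>\<^sub>M Y)"
      by measurable
    have "emeasure (density P ?u) A = (\<integral>\<^sup>+ x. \<integral>\<^sup>+ y. ?h (x, y) \<partial>K x \<partial>P)"
      by (subst emeasure_density[OF u A], intro nn_integral_cong) (auto simp: indicator_def)
    also have "\<dots> = (\<integral>\<^sup>+ x. \<integral>\<^sup>+ y. ennreal (\<rho> x y) * ?h (x, y) \<partial>W \<partial>P)"
      using nn_integral_joint[OF h''] nn_integral_joint_density[OF h''] by simp
    also have "\<dots> = emeasure (density P ?v) A"
      by (subst emeasure_density[OF v A], intro nn_integral_cong) (auto simp: indicator_def)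
    finally show "emeasure (density P ?u) A = emeasure (density P ?v) A" .
  qed simp
qed

lemma nn_integral_density_ratio: "AE x in P. (\<integral>\<^sup>+ y. ennreal (\<rho> x y) \<partial>W) = 1"
proof -
  have "AE x in P. (\<integral>\<^sup>+ y. 1 \<partial>K x) = (\<integral>\<^sup>+ y. ennreal (\<rho> x y) * 1 \<partial>W)"
    using nn_integral_K_density[of "\<lambda>_. 1"] by simp
  then show ?thesis
    using AE_space
    by eventually_elim (simp add: prob_space.emeasure_space_1[OF K_prob])
qed

end

subsection \<open>Reduction of the scheme to soft covering\<close>

text \<open>The rewrite rule turns \<open>{1..n}\<close> into \<open>{Suc 0..n}\<close> and so blocks facts about these index sets.\<close>

declare One_nat_def [simp del]

text \<open>Rounding up can only enlarge the codebook.\<close>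

lemma codebook_size_ge: "2 powr (real n * R) \<le> real (codebook_size n R)"
proof -
  have "2 powr (real n * R) \<le> of_int \<lceil>2 powr (real n * R)\<rceil>"
    by (rule le_of_int_ceiling)
  also have "\<dots> \<le> real (codebook_size n R)"
    unfolding codebook_size_def by simp
  finally show ?thesis .
qed

lemma codebook_size_pos: "0 < codebook_size n R"
  using codebook_size_ge[of n R] by (metis of_nat_0_less_iff order_less_le_trans powr_gt_zero zero_neq_numeral)

text \<open>If \<open>s\<close> vanishes, the last summand equals 1 and dominates any fallback
  distribution. Otherwise \<open>l m = s * e m\<close> gives
  \<open>e m * i m = l m * i m / N + e m * i m * (1 - s / N)\<close>, and the weights
  \<open>e\<close> sum to 1.\<close>

lemma weighted_average_le:
  fixes l e i :: "nat \<Rightarrow> real" and N :: nat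
  assumes l: "\<And>m. 0 \<le> l m" and i: "\<And>m. 0 \<le> i m" "\<And>m. i m \<le> 1" and N: "0 < N"
    and s: "s = (\<Sum>m = 1..N. l m)"
    and e: "\<And>m. 0 \<le> e m" "(\<Sum>m = 1..N. e m) = 1" "\<And>m. s \<noteq> 0 \<Longrightarrow> e m = l m / s"
  shows "(\<Sum>m = 1..N. e m * i m) \<le> (\<Sum>m = 1..N. l m * i m) / N + max 0 (1 - s / N)"
proof (cases "s = 0")
  case True
  have "(\<Sum>m = 1..N. e m * i m) \<le> (\<Sum>m = 1..N. e m * 1)"
    by (intro sum_mono mult_left_mono i e)
  moreover have "0 \<le> (\<Sum>m = 1..N. l m * i m) / N"
    by (intro divide_nonneg_nonneg sum_nonneg mult_nonneg_nonneg l i) simp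
  ultimately show ?thesis
    using True e by simp
next
  case False
  have "e m * i m \<le> l m * i m / N + e m * max 0 (1 - s / N)" for m
  proof -
    have "l m = s * e m"
      using False e(3)[of m] by simp
    then have "e m * i m = l m * i m / N + e m * i m * (1 - s / N)"
      by (simp add: algebra_simps)
    also have "e m * i m * (1 - s / N) \<le> e m * i m * max 0 (1 - s / N)"
      by (intro mult_left_mono mult_nonneg_nonneg e i) simp
    also have "\<dots> \<le> e m * 1 * max 0 (1 - s / N)"
      by (intro mult_right_mono mult_left_mono e i) simp
    finally show ?thesis by simp
  qed
  then have "(\<Sum>m = 1..N. e m * i m) \<le> (\<Sum>m = 1..N. l m * i m / N + e m * max 0 (1 - s / N))"
    by (rule sum_mono)
  also have "\<dots> = (\<Sum>m = 1..N. l m * i m) / N + (\<Sum>m = 1..N. e m) * max 0 (1 - s / N)"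
    by (simp only: sum.distrib sum_divide_distrib sum_distrib_right)
  finally show ?thesis
    by (simp add: e)
qed

text \<open>The condition on \<open>q\<close> places the fallback on valid indices, so the encoder
  has total mass 1 also when all likelihoods vanish.\<close>

locale likelihood_scheme = source_channel P Y K
  for P :: "'x measure" and Y :: "'y measure" and K +
  fixes d :: "'x \<Rightarrow> 'y \<Rightarrow> real" and R D :: real and n :: nat and q :: "nat pmf"
  assumes d_meas: "case_prod d \<in> borel_measurable (P \<Otimes>\<^sub>M Y)"
    and n_pos: "0 < n"
    and q: "set_pmf q \<subseteq> {1..codebook_size n R}"
begin

sublocale block_likelihood P W \<rho> n
  using measurable_density_ratio density_ratio_nonneg nn_integral_density_ratio
  by unfold_locales

abbreviation N where "N \<equiv> codebook_size n R"
abbreviation C where "C \<equiv> Pi\<^sub>M {1..N} (\<lambda>_. Wn)"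
abbreviation e where "e \<equiv> encoder_prob P Y K n R q"

sublocale C: prob_space C
  by (intro prob_space_PiM Wn.prob_space_axioms)

lemma likelihood_eq: "likelihood P Y K n c x m = L x (c m)"
  by (simp add: likelihood_def L_def)

lemma codebook_law_eq: "codebook_law P Y K n R = C"
  by (simp add: codebook_law_def)

lemma encoder_prob_eq:
  "e c x m = (if (\<Sum>m' = 1..N. L x (c m')) = 0 then pmf q m else L x (c m) / (\<Sum>m' = 1..N. L x (c m')))"
  by (simp add: encoder_prob_def likelihood_eq Let_def)

lemma encoder_prob_nonneg: "0 \<le> e c x m"
  unfolding encoder_prob_eq by (auto intro!: divide_nonneg_nonneg sum_nonneg L_nonneg)

lemma sum_encoder_prob: "(\<Sum>m = 1..N. e c x m) = 1"
proof (cases "(\<Sum>m = 1..N. L x (c m)) = 0")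
  case True
  then show ?thesis
    using sum_pmf_eq_1[OF _ q] by (simp add: encoder_prob_eq)
next
  case False
  then show ?thesis
    by (simp add: encoder_prob_eq sum_divide_distrib[symmetric])
qed

lemma measurable_d [measurable (raw)]:
  assumes "g \<in> M \<rightarrow>\<^sub>M P" "h \<in> M \<rightarrow>\<^sub>M Y"
  shows "(\<lambda>z. d (g z) (h z)) \<in> borel_measurable M"
  using measurable_compose[OF measurable_Pair[OF assms] d_meas] by simp

abbreviation Yn where "Yn \<equiv> Pi\<^sub>M {1..n} (\<lambda>_. Y)"

lemma sets_Wn [measurable_cong, simp]: "sets Wn = sets Yn"
  by (intro sets_PiM_cong) simp_all

lemma measurable_block_distortion [measurable (raw)]:
  assumes [measurable]: "g \<in> M \<rightarrow>\<^sub>M Pn" "h \<in> M \<rightarrow>\<^sub>M Yn"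
  shows "(\<lambda>z. block_distortion d n (g z) (h z)) \<in> borel_measurable M"
  unfolding block_distortion_def
proof (intro borel_measurable_times borel_measurable_const borel_measurable_sum measurable_d)
  fix t assume t: "t \<in> {1..n}"
  show "(\<lambda>z. g z t) \<in> M \<rightarrow>\<^sub>M P" "(\<lambda>z. h z t) \<in> M \<rightarrow>\<^sub>M Y"
    using measurable_compose[OF assms(1) measurable_component_singleton[OF t]]
      measurable_compose[OF assms(2) measurable_component_singleton[OF t]] by auto
qed

definition exceeds :: "(nat \<Rightarrow> 'x) \<Rightarrow> (nat \<Rightarrow> 'y) \<Rightarrow> real" where
  "exceeds x y = indicator {D<..} (block_distortion d n x y)"

lemma exceeds_nonneg: "0 \<le> exceeds x y"
  by (simp add: exceeds_def)

lemma measurable_exceeds [measurable (raw)]: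
  assumes "g \<in> M \<rightarrow>\<^sub>M Pn" "h \<in> M \<rightarrow>\<^sub>M Yn"
  shows "(\<lambda>z. exceeds (g z) (h z)) \<in> borel_measurable M"
  unfolding exceeds_def
  by (rule measurable_compose[OF measurable_block_distortion[OF assms]]) simp

abbreviation T where "T \<equiv> Pn \<Otimes>\<^sub>M count_space {1..N} \<Otimes>\<^sub>M Yn"

lemma codeword_in_space_Wn:
  assumes "c \<in> space C" "m \<in> {1..N}"
  shows "c m \<in> space Wn"
  using measurable_space[OF measurable_component_singleton[OF assms(2)] assms(1)] .

lemma codeword_in_space:
  assumes "c \<in> space C" "m \<in> {1..N}"
  shows "c m \<in> space Yn"
  using codeword_in_space_Wn[OF assms] sets_eq_imp_space_eq[OF sets_Wn] by simp

abbreviation kernel where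
  "kernel c x \<equiv> distr (encoder P Y K n R q c x) T (\<lambda>m. (x, m, c m))"

lemma kernel_map_measurable:
  assumes "c \<in> space C" "x \<in> space Pn"
  shows "(\<lambda>m. (x, m, c m)) \<in> encoder P Y K n R q c x \<rightarrow>\<^sub>M T"
  unfolding encoder_def using assms codeword_in_space[OF assms(1)]
  by (auto simp: space_pair_measure)

lemma emeasure_kernel:
  assumes c: "c \<in> space C" and x: "x \<in> space Pn" and A: "A \<in> sets T"
  shows "emeasure (kernel c x) A = (\<Sum>m = 1..N. ennreal (e c x m) * indicator A (x, m, c m))"
proof -
  let ?A = "{m \<in> {1..N}. (x, m, c m) \<in> A}"
  have "emeasure (kernel c x) A = emeasure (encoder P Y K n R q c x) ?A"
    by (subst emeasure_distr[OF kernel_map_measurable[OF c x] A])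
       (auto simp: encoder_def space_point_measure intro!: arg_cong[where f = "emeasure _"])
  also have "\<dots> = (\<Sum>m\<in>?A. ennreal (e c x m))"
    unfolding encoder_def by (rule emeasure_point_measure_finite) auto
  also have "\<dots> = (\<Sum>m = 1..N. if (x, m, c m) \<in> A then ennreal (e c x m) else 0)"
    by (rule sum.inter_filter) simp
  also have "\<dots> = (\<Sum>m = 1..N. ennreal (e c x m) * indicator A (x, m, c m))"
    by (intro sum.cong) (auto simp: indicator_def)
  finally show ?thesis .
qed

lemma measurable_encoder_prob:
  assumes c: "c \<in> space C" and m: "m \<in> {1..N}"
  shows "(\<lambda>x. e c x m) \<in> borel_measurable Pn"
proof -
  have [measurable]: "(\<lambda>x. L x (c m)) \<in> borel_measurable Pn" if "m \<in> {1..N}" for m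
    using codeword_in_space_Wn[OF c that] by (intro measurable_L measurable_const) simp_all
  show ?thesis
    unfolding encoder_prob_eq using m by measurable
qed

text \<open>Evaluating the bind in \<open>scheme_law\<close> requires a measurable kernel. For a
  fixed codebook the mass of each event is a finite sum over indices of measurable functions of the
  source block.\<close>

lemma measurable_kernel:
  assumes c: "c \<in> space C"
  shows "kernel c \<in> Pn \<rightarrow>\<^sub>M subprob_algebra T"
proof (rule measurable_subprob_algebra)
  fix x assume x: "x \<in> space Pn"
  show "subprob_space (kernel c x)"
  proof (rule prob_space_imp_subprob_space, rule prob_spaceI)
    have "emeasure (kernel c x) (space (kernel c x)) = (\<Sum>m = 1..N. ennreal (e c x m) * indicator (space T) (x, m, c m))"
      by (subst emeasure_kernel[OF c x, symmetric]) (simp_all only: sets.top space_distr)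
    also have "\<dots> = (\<Sum>m = 1..N. ennreal (e c x m))"
      using x codeword_in_space[OF c] by (intro sum.cong) (auto simp: space_pair_measure)
    also have "\<dots> = 1"
      by (subst sum_ennreal) (simp_all only: encoder_prob_nonneg sum_encoder_prob ennreal_1)
    finally show "emeasure (kernel c x) (space (kernel c x)) = 1" .
  qed
next
  fix A assume A: "A \<in> sets T"
  have "(\<lambda>x. \<Sum>m = 1..N. ennreal (e c x m) * indicator A (x, m, c m)) \<in> borel_measurable Pn"
  proof (intro borel_measurable_sum borel_measurable_times_ennreal)
    fix m assume m: "m \<in> {1..N}"
    show "(\<lambda>x. ennreal (e c x m)) \<in> borel_measurable Pn"
      using measurable_encoder_prob[OF c m] by measurable
    have "(\<lambda>x. (x, m, c m)) \<in> Pn \<rightarrow>\<^sub>M T"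
      using m codeword_in_space[OF c m] by (intro measurable_Pair measurable_ident measurable_const) simp_all
    then show "(\<lambda>x. indicator A (x, m, c m) :: ennreal) \<in> borel_measurable Pn"
      using A by (rule measurable_compose[OF _ borel_measurable_indicator])
  qed
  then show "(\<lambda>x. emeasure (kernel c x) A) \<in> borel_measurable Pn"
    by (subst measurable_cong[OF emeasure_kernel[OF c _ A]])
qed simp

lemma excess_prob_eq:
  assumes c: "c \<in> space C"
  shows "excess_prob P Y d R D n K q c
    = (\<integral>\<^sup>+ x. ennreal (\<Sum>m = 1..N. e c x m * exceeds x (c m)) \<partial>Pn)"
proof -
  have sets: "sets (scheme_law P Y K n R q c) = sets T"
    unfolding scheme_law_def by (rule sets_bind) (simp_all only: sets_distr Pn.not_empty not_False_eq_True)
  have space: "space (scheme_law P Y K n R q c) = space T"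
    by (rule sets_eq_imp_space_eq[OF sets])
  let ?A = "{(x, m, y) \<in> space T. block_distortion d n x y > D}"
  have "?A = {z \<in> space T. D < block_distortion d n (fst z) (snd (snd z))}"
    by (auto simp: case_prod_unfold)
  also have "\<dots> \<in> sets T"
    by measurable
  finally have A: "?A \<in> sets T" .
  have "excess_prob P Y d R D n K q c = emeasure (Pn \<bind> kernel c) ?A"
    unfolding excess_prob_def space by (simp add: scheme_law_def)
  also have "\<dots> = (\<integral>\<^sup>+ x. emeasure (kernel c x) ?A \<partial>Pn)"
    by (rule emeasure_bind[OF Pn.not_empty measurable_kernel[OF c] A])
  also have "\<dots> = (\<integral>\<^sup>+ x. ennreal (\<Sum>m = 1..N. e c x m * exceeds x (c m)) \<partial>Pn)"
  proof (rule nn_integral_cong)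
    fix x assume x: "x \<in> space Pn"
    have "emeasure (kernel c x) ?A = (\<Sum>m = 1..N. ennreal (e c x m) * indicator ?A (x, m, c m))"
      by (rule emeasure_kernel[OF c x A])
    also have "\<dots> = (\<Sum>m = 1..N. ennreal (e c x m * exceeds x (c m)))"
      using x codeword_in_space[OF c]
      by (intro sum.cong) (auto simp: exceeds_def indicator_def space_pair_measure)
    also have "\<dots> = ennreal (\<Sum>m = 1..N. e c x m * exceeds x (c m))"
      by (rule sum_ennreal) (simp add: encoder_prob_nonneg exceeds_def)
    finally show "emeasure (kernel c x) ?A = ennreal (\<Sum>m = 1..N. e c x m * exceeds x (c m))" .
  qed
  finally show ?thesis .
qed

text \<open>The bound of \<open>weighted_average_le\<close> is integrated over source and codebook.
  Every codeword has law \<open>Wn\<close>, so the average over the indices collapses to one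
  integral.\<close>

lemma expected_excess_prob_le:
  "expected_excess_prob P Y d R D n K q
    \<le> (\<integral>\<^sup>+ y. \<integral>\<^sup>+ x. ennreal (L x y * exceeds x y) \<partial>Pn \<partial>Wn)
      + (\<integral>\<^sup>+ x. \<integral>\<^sup>+ c. ennreal (max 0 (1 - (\<Sum>m = 1..N. L x (c m)) / N)) \<partial>C \<partial>Pn)"
proof -
  interpret CP: pair_prob_space C Pn ..
  have N: "0 < N"
    by (rule codebook_size_pos)
  define g where "g y = (\<integral>\<^sup>+ x. ennreal (L x y * exceeds x y) \<partial>Pn)" for y
  have g [measurable]: "g \<in> borel_measurable Wn"
    unfolding g_def by measurable
  define h where "h c x = ennreal (max 0 (1 - (\<Sum>m = 1..N. L x (c m)) / N))" for c x
  have Lc [measurable]: "(\<lambda>z. L (snd z) (fst z m)) \<in> borel_measurable (C \<Otimes>\<^sub>M Pn)"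
    if m: "m \<in> {1..N}" for m
    by (rule measurable_L[OF measurable_snd measurable_compose[OF measurable_fst measurable_component_singleton[OF m]]])
  have h [measurable]: "case_prod h \<in> borel_measurable (C \<Otimes>\<^sub>M Pn)"
    unfolding h_def case_prod_unfold by measurable
  have "excess_prob P Y d R D n K q c \<le> ennreal (1 / N) * (\<Sum>m = 1..N. g (c m)) + (\<integral>\<^sup>+ x. h c x \<partial>Pn)"
    if c: "c \<in> space C" for c
  proof -
    have Lm [measurable]: "(\<lambda>x. L x (c m)) \<in> borel_measurable Pn"
      "(\<lambda>x. exceeds x (c m)) \<in> borel_measurable Pn" if "m \<in> {1..N}" for m
      using codeword_in_space_Wn[OF c that] codeword_in_space[OF c that]
      by (auto intro!: measurable_L measurable_exceeds measurable_const)
    have "excess_prob P Y d R D n K q c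
        \<le> (\<integral>\<^sup>+ x. (\<Sum>m = 1..N. ennreal (1 / N) * ennreal (L x (c m) * exceeds x (c m))) + h c x \<partial>Pn)"
      unfolding excess_prob_eq[OF c]
    proof (rule nn_integral_mono)
      fix x
      have "(\<Sum>m = 1..N. e c x m * exceeds x (c m))
          \<le> (\<Sum>m = 1..N. L x (c m) * exceeds x (c m)) / N + max 0 (1 - (\<Sum>m = 1..N. L x (c m)) / N)"
        by (intro weighted_average_le[where l = "\<lambda>m. L x (c m)", OF _ _ _ N refl encoder_prob_nonneg sum_encoder_prob])
           (simp_all only: L_nonneg exceeds_def indicator_pos_le indicator_le_1 encoder_prob_eq if_False)
      also have "(\<Sum>m = 1..N. L x (c m) * exceeds x (c m)) / N
          = (\<Sum>m = 1..N. 1 / N * (L x (c m) * exceeds x (c m)))"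
        by (simp add: sum_divide_distrib)
      finally have *: "ennreal (\<Sum>m = 1..N. e c x m * exceeds x (c m))
          \<le> ennreal ((\<Sum>m = 1..N. 1 / N * (L x (c m) * exceeds x (c m)))
            + max 0 (1 - (\<Sum>m = 1..N. L x (c m)) / N))"
        by (rule ennreal_leI)
      have "0 \<le> (\<Sum>m = 1..N. 1 / N * (L x (c m) * exceeds x (c m)))"
        by (intro sum_nonneg mult_nonneg_nonneg L_nonneg exceeds_nonneg) simp
      with * have "ennreal (\<Sum>m = 1..N. e c x m * exceeds x (c m))
          \<le> ennreal (\<Sum>m = 1..N. 1 / N * (L x (c m) * exceeds x (c m))) + h c x"
        unfolding h_def by (simp only: ennreal_plus max.cobounded1)
      also have "ennreal (\<Sum>m = 1..N. 1 / N * (L x (c m) * exceeds x (c m)))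
          = (\<Sum>m = 1..N. ennreal (1 / N * (L x (c m) * exceeds x (c m))))"
        by (intro sum_ennreal[symmetric] mult_nonneg_nonneg L_nonneg exceeds_nonneg) simp
      also have "\<dots> = (\<Sum>m = 1..N. ennreal (1 / N) * ennreal (L x (c m) * exceeds x (c m)))"
        by (intro sum.cong refl ennreal_mult mult_nonneg_nonneg L_nonneg exceeds_nonneg) simp
      finally show "ennreal (\<Sum>m = 1..N. e c x m * exceeds x (c m))
          \<le> (\<Sum>m = 1..N. ennreal (1 / N) * ennreal (L x (c m) * exceeds x (c m))) + h c x" .
    qed
    also have "\<dots> = (\<Sum>m = 1..N. ennreal (1 / N) * g (c m)) + (\<integral>\<^sup>+ x. h c x \<partial>Pn)"
    proof (subst nn_integral_add)
      show "h c \<in> borel_measurable Pn"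
        using measurable_compose[OF measurable_Pair1'[OF c] h] by simp
    qed (simp_all add: nn_integral_sum nn_integral_cmult g_def)
    finally show ?thesis
      by (simp only: sum_distrib_left)
  qed
  then have "expected_excess_prob P Y d R D n K q
      \<le> (\<integral>\<^sup>+ c. ennreal (1 / N) * (\<Sum>m = 1..N. g (c m)) + (\<integral>\<^sup>+ x. h c x \<partial>Pn) \<partial>C)"
    unfolding expected_excess_prob_def codebook_law_eq by (rule nn_integral_mono)
  also have "\<dots> = ennreal (1 / N) * (\<Sum>m = 1..N. \<integral>\<^sup>+ c. g (c m) \<partial>C) + (\<integral>\<^sup>+ c. \<integral>\<^sup>+ x. h c x \<partial>Pn \<partial>C)"
    by (subst nn_integral_add) (measurable, simp add: nn_integral_cmult nn_integral_sum)
  also have "(\<Sum>m = 1..N. \<integral>\<^sup>+ c. g (c m) \<partial>C) = (\<Sum>m = 1..N. integral\<^sup>N Wn g)"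
    by (intro sum.cong refl Wn.nn_integral_PiM_component g)
  also have "ennreal (1 / N) * \<dots> = integral\<^sup>N Wn g"
    using N by (simp add: mult.assoc[symmetric] ennreal_of_nat_eq_real_of_nat ennreal_mult[symmetric])
  \<comment> \<open>Soft covering fixes the source block and averages over codebooks, hence the
    exchange.\<close>
  also have "(\<integral>\<^sup>+ c. \<integral>\<^sup>+ x. h c x \<partial>Pn \<partial>C) = (\<integral>\<^sup>+ x. \<integral>\<^sup>+ c. h c x \<partial>C \<partial>Pn)"
    by (rule CP.Fubini'[OF h, symmetric])
  finally show ?thesis
    unfolding g_def h_def .
qed

text \<open>Excess distortion means that the sum of the \<open>d (x t) (y t) - D\<close> is
  positive, so 2 to any positive multiple of it is at least 1. The product form is ready to factor
  over the letters.\<close>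

lemma exceeds_le:
  assumes \<beta>: "0 < \<beta>"
  shows "exceeds x y \<le> (\<Prod>t = 1..n. 2 powr (\<beta> * (d (x t) (y t) - D)))"
proof (cases "D < block_distortion d n x y")
  case True
  then have "n * D < (\<Sum>t = 1..n. d (x t) (y t))"
    using n_pos by (simp add: block_distortion_def field_simps)
  then have "0 \<le> \<beta> * (\<Sum>t = 1..n. d (x t) (y t) - D)"
    using \<beta> by (simp add: sum_subtractf)
  then have "1 \<le> 2 powr (\<Sum>t = 1..n. \<beta> * (d (x t) (y t) - D))"
    by (intro ge_one_powr_ge_zero) (simp_all add: sum_distrib_left)
  then show ?thesis
    using True by (simp add: exceeds_def powr_sum)
qed (auto simp: exceeds_def intro!: prod_nonneg)

text \<open>The left-hand side is the excess probability under the \<open>n\<close>-fold joint law, which has density \<open>L\<close>.\<close>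

lemma chernoff:
  assumes \<beta>: "0 < \<beta>"
  shows "(\<integral>\<^sup>+ y. \<integral>\<^sup>+ x. ennreal (L x y * exceeds x y) \<partial>Pn \<partial>Wn)
    \<le> (\<integral>\<^sup>+ (x, y). ennreal (2 powr (\<beta> * (d x y - D))) \<partial>joint_law P Y K) ^ n"
proof -
  interpret WP: pair_prob_space Wn Pn ..
  let ?G = "\<lambda>x y. ennreal (\<rho> x y) * ennreal (2 powr (\<beta> * (d x y - D)))"
  have [measurable]: "case_prod ?G \<in> borel_measurable (P \<Otimes>\<^sub>M W)"
    by measurable
  have "(\<integral>\<^sup>+ y. \<integral>\<^sup>+ x. ennreal (L x y * exceeds x y) \<partial>Pn \<partial>Wn) = (\<integral>\<^sup>+ x. \<integral>\<^sup>+ y. ennreal (L x y * exceeds x y) \<partial>Wn \<partial>Pn)"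
    by (rule WP.Fubini'[symmetric]) measurable
  also have "\<dots> \<le> (\<integral>\<^sup>+ x. \<integral>\<^sup>+ y. (\<Prod>t = 1..n. ?G (x t) (y t)) \<partial>Wn \<partial>Pn)"
  proof (intro nn_integral_mono)
    fix x y
    have "ennreal (L x y * exceeds x y) \<le> ennreal (L x y * (\<Prod>t = 1..n. 2 powr (\<beta> * (d (x t) (y t) - D))))"
      by (intro ennreal_leI mult_left_mono exceeds_le \<beta> L_nonneg)
    also have "\<dots> = ennreal (\<Prod>t = 1..n. \<rho> (x t) (y t) * 2 powr (\<beta> * (d (x t) (y t) - D)))"
      by (simp only: L_def prod.distrib)
    also have "\<dots> = (\<Prod>t = 1..n. ?G (x t) (y t))"
      by (simp only: ennreal_mult[symmetric] density_ratio_nonneg powr_ge_zero prod_ennreal mult_nonneg_nonneg)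
    finally show "ennreal (L x y * exceeds x y) \<le> (\<Prod>t = 1..n. ?G (x t) (y t))" .
  qed
  also have "\<dots> = (\<integral>\<^sup>+ x. (\<Prod>t = 1..n. \<integral>\<^sup>+ y. ?G (x t) y \<partial>W) \<partial>Pn)"
    by (intro nn_integral_cong nn_integral_Wn_prod[where g = ?G]) simp_all
  also have "\<dots> = (\<integral>\<^sup>+ x. \<integral>\<^sup>+ y. ?G x y \<partial>W \<partial>P) ^ n"
    by (rule nn_integral_Pn_prod) measurable
  also have "(\<integral>\<^sup>+ x. \<integral>\<^sup>+ y. ?G x y \<partial>W \<partial>P)
      = (\<integral>\<^sup>+ (x, y). ennreal (2 powr (\<beta> * (d x y - D))) \<partial>joint_law P Y K)"
    by (subst nn_integral_joint_density) simp_all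
  finally show ?thesis .
qed

end

subsection \<open>Optimisation of the exponents\<close>

lemma eexp2_mono: "a \<le> b \<Longrightarrow> eexp2 a \<le> eexp2 b"
  unfolding eexp2_def by (cases a; cases b) (auto intro!: ennreal_leI)

text \<open>A finite value of \<open>I_check\<close> or \<open>I_bar\<close> rules out the arguments
  0 and infinity of the logarithm, so the moment can be recovered from the information
  quantity.\<close>

lemma elog2_finiteD:
  assumes "\<bar>ereal r * elog2 U\<bar> \<noteq> \<infinity>" "r \<noteq> 0"
  obtains u where "0 < u" "U = ennreal u" "real_of_ereal (ereal r * elog2 U) = r * log 2 u"
proof -
  have "U \<noteq> 0" "U \<noteq> \<infinity>"
    using assms by (cases "0 < r"; force simp: elog2_def)+
  then obtain u where "0 < u" "U = ennreal u"
    by (cases U) (auto simp: less_le)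
  then show ?thesis
    using that by (simp add: elog2_def)
qed

text \<open>The conventions agree at the ends: a zero infimum gives an infinite exponent and bound
  0, an infinite one gives exponent -\<infinity> and bound \<infinity>.\<close>

lemma eexp2_neg_elog2_inverse:
  assumes n: "0 < n"
  shows "eexp2 (- (ereal (real n) * elog2 (inverse I))) = I ^ n"
proof (cases I)
  case (real i)
  show ?thesis
  proof (cases "i = 0")
    case True
    then show ?thesis
      using real n by (simp add: elog2_def eexp2_def)
  next
    case False
    then have i: "0 < i"
      using real by simp
    then have "2 powr (- (real n * log 2 (inverse i))) = i ^ n"
      by (simp add: log_inverse powr_realpow[symmetric] powr_powr[symmetric] mult.commute[of "real n"])
    moreover have "inverse I = ennreal (inverse i)"
      using real i by (simp add: inverse_ennreal)
    ultimately show ?thesis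
      using i real by (simp add: elog2_def eexp2_def ennreal_power)
  qed
next
  case top
  then show ?thesis
    using n by (simp add: elog2_def eexp2_def)
qed

text \<open>The infimum need not be attained; it is approached by \<open>i + \<epsilon>\<close>, and
  continuity of the power lets \<epsilon> tend to 0.\<close>

lemma le_INF_power:
  fixes v :: "'b \<Rightarrow> ennreal"
  assumes le: "\<And>\<beta>. \<beta> \<in> S \<Longrightarrow> A \<le> v \<beta> ^ n" and n: "0 < n"
  shows "A \<le> (INF \<beta>\<in>S. v \<beta>) ^ n"
proof (cases "INF \<beta>\<in>S. v \<beta>")
  case (real i)
  have *: "A \<le> ennreal ((i + \<epsilon>) ^ n)" if "0 < \<epsilon>" for \<epsilon>
  proof -
    have "(INF \<beta>\<in>S. v \<beta>) < ennreal (i + \<epsilon>)"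
      using real that by (simp add: ennreal_less_iff)
    then obtain \<beta> where "\<beta> \<in> S" "v \<beta> < ennreal (i + \<epsilon>)"
      unfolding INF_less_iff by blast
    then have "A \<le> ennreal (i + \<epsilon>) ^ n"
      using le[of \<beta>] by (meson less_imp_le order_trans power_mono zero_le)
    moreover have "ennreal (i + \<epsilon>) ^ n = ennreal ((i + \<epsilon>) ^ n)"
      using real that by (intro ennreal_power) simp
    ultimately show ?thesis
      by simp
  qed
  have "(\<lambda>k. ennreal ((i + inverse (real (Suc k))) ^ n)) \<longlonglongrightarrow> ennreal ((i + 0) ^ n)"
    by (intro tendsto_ennrealI tendsto_power tendsto_add tendsto_const LIMSEQ_inverse_real_of_nat)
  then have "A \<le> ennreal ((i + 0) ^ n)"
    by (rule LIMSEQ_le_const) (intro exI[of _ 0] allI impI *, simp)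
  then show ?thesis
    using real by (simp add: ennreal_power)
next
  case top
  then show ?thesis
    using n by simp
qed

text \<open>The supremum may be infinite or not attained, so the inequality is inverted: for
  positive finite \<open>C\<close> each \<open>g s\<close> is bounded by a constant, hence so is the
  supremum. An infinite \<open>C\<close> forces \<open>S\<close> to be empty, where the supremum is
  -\<infinity> and the right-hand side infinite.\<close>

lemma le_eexp2_SUP:
  fixes g :: "'b \<Rightarrow> real"
  assumes le: "\<And>s. s \<in> S \<Longrightarrow> C \<le> ennreal (2 powr (- (real n * g s)))" and n: "0 < n"
  shows "C \<le> eexp2 (- (ereal (real n) * (SUP s\<in>S. ereal (g s))))"
proof (cases C)
  case (real c)
  show ?thesis
  proof (cases "c = 0")
    case False
    then have c: "0 < c"
      using real by simp
    have "g s \<le> - log 2 c / real n" if "s \<in> S" for s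
    proof -
      have "c \<le> 2 powr (- (real n * g s))"
        using le[OF that] real by (simp add: ennreal_le_iff)
      then have "log 2 c \<le> - (real n * g s)"
        using c by (simp add: log_le_iff)
      then show ?thesis
        using n by (simp add: field_simps)
    qed
    then have "(SUP s\<in>S. ereal (g s)) \<le> ereal (- log 2 c / real n)"
      by (intro SUP_least) simp
    then have "ereal (real n) * (SUP s\<in>S. ereal (g s)) \<le> ereal (real n) * ereal (- log 2 c / real n)"
      by (rule ereal_mult_left_mono) simp
    also have "\<dots> = - ereal (log 2 c)"
      using n by simp
    finally have "eexp2 (ereal (log 2 c)) \<le> eexp2 (- (ereal (real n) * (SUP s\<in>S. ereal (g s))))"
      by (intro eexp2_mono) (metis ereal_minus_le_minus ereal_uminus_uminus)
    moreover have "eexp2 (ereal (log 2 c)) = C"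
      using c real by (simp add: eexp2_def)
    ultimately show ?thesis
      by simp
  qed (use real in simp)
next
  case top
  then have "S = {}"
    using le by (auto simp: top_unique)
  then show ?thesis
    using n by (simp add: bot_ereal_def eexp2_def)
qed

section \<open>Balancing the threshold and assembling the two error terms\<close>

context likelihood_scheme
begin

text \<open>Soft covering is used with a = \<alpha> - 1, b = \<alpha>' - 1 and threshold
  \<open>2 powr (real n * \<tau>)\<close>. The tail contributes weight 1 and the variance weight
  1/2, both with exponent \<open>gamma_term\<close>.\<close>

lemma covering_le:
  assumes g: "(\<alpha>, \<alpha>') \<in> gamma_domain P Y K"
  shows "(\<integral>\<^sup>+ x. \<integral>\<^sup>+ c. ennreal (max 0 (1 - (\<Sum>m = 1..N. L x (c m)) / N)) \<partial>C \<partial>Pn)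
    \<le> ennreal (3 / 2 * 2 powr (- (real n * gamma_term P Y R K \<alpha> \<alpha>')))" (is "?B \<le> _")
proof (cases "\<alpha> = 1")
  \<comment> \<open>Here the prefactor \<alpha> - 1 makes \<open>gamma_term\<close> zero, and the
    trivial bound 1 on the shortfall suffices.\<close>
  case True
  have "?B \<le> (\<integral>\<^sup>+ x. \<integral>\<^sup>+ c. 1 \<partial>C \<partial>Pn)"
    by (intro nn_integral_mono) (auto intro!: divide_nonneg_nonneg sum_nonneg L_nonneg simp: ennreal_le_1)
  also have "\<dots> = 1"
    by (simp add: C.emeasure_space_1 Pn.emeasure_space_1)
  also have "\<dots> \<le> ennreal (3 / 2 * 2 powr (- (real n * gamma_term P Y R K \<alpha> \<alpha>')))"
    using True by (simp add: gamma_term_def ennreal_ge_1)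
  finally show ?thesis .
next
  case False
  define a b where "a = \<alpha> - 1" and "b = \<alpha>' - 1"
  have a: "0 < a" and b: "b \<le> 1"
    using g False by (auto simp: gamma_domain_def a_def b_def)
  define ic where "ic = real_of_ereal (I_check P Y K \<alpha>)"
  define ib where "ib = real_of_ereal (I_bar P Y K \<alpha>')"
  have meas: "(\<lambda>z. ennreal (case_prod \<rho> z powr e)) \<in> borel_measurable (P \<Otimes>\<^sub>M Y)" for e
    using measurable_density_ratio by (simp add: borel_measurable_PW)
  have meas': "(\<lambda>(x, y). ennreal (\<rho> x y powr e)) \<in> borel_measurable (P \<Otimes>\<^sub>M Y)" for e
    using meas[of e] by (simp add: case_prod_unfold)
  have mult: "ennreal (\<rho> x y) * ennreal (\<rho> x y powr e) = ennreal (\<rho> x y * \<rho> x y powr e)" for x y e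
    by (rule ennreal_mult[symmetric]) (simp_all add: density_ratio_nonneg)
  define U where "U = (\<integral>\<^sup>+ x. \<integral>\<^sup>+ y. ennreal (\<rho> x y * \<rho> x y powr a) \<partial>W \<partial>P)"
  define V where "V = (\<integral>\<^sup>+ x. esqrt (\<integral>\<^sup>+ y. ennreal (\<rho> x y * \<rho> x y powr b) \<partial>W) \<partial>P)"
  have U: "U = ennreal (2 powr (a * ic))"
  proof -
    have "U = (\<integral>\<^sup>+ (x, y). ennreal (\<rho> x y powr a) \<partial>joint_law P Y K)"
      by (simp add: U_def nn_integral_joint_density[OF meas'] mult)
    then have I: "I_check P Y K \<alpha> = ereal (1 / a) * elog2 U"
      using False by (simp add: I_check_def a_def)
    moreover have "\<bar>I_check P Y K \<alpha>\<bar> \<noteq> \<infinity>"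
      using g by (simp add: gamma_domain_def)
    ultimately obtain u where "0 < u" "U = ennreal u" "ic = 1 / a * log 2 u"
      unfolding ic_def using elog2_finiteD[of "1 / a" U] a by auto
    then show ?thesis
      using a by simp
  qed
  have V: "V \<le> ennreal (2 powr (b * ib / 2))"
  proof -
    have V: "V = (\<integral>\<^sup>+ x. esqrt (\<integral>\<^sup>+ y. ennreal (\<rho> x y powr b) \<partial>K x) \<partial>P)"
      unfolding V_def using nn_integral_K_density[OF meas'[of b]]
      by (intro nn_integral_cong_AE, eventually_elim) (simp add: mult)
    show ?thesis
    \<comment> \<open>At \<alpha>' = 1 the value of \<open>I_bar\<close> is meaningless but is
      multiplied by b = 0, so the claim is V \<le> 1. Since \<open>0 powr 0 = 0\<close>, the
      integrand is bounded by 1 rather than equal to it.\<close>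
    proof (cases "b = 0")
      case True
      have "V \<le> (\<integral>\<^sup>+ x. 1 \<partial>P)"
        unfolding V
      proof (rule nn_integral_mono)
        fix x assume x: "x \<in> space P"
        have "(\<integral>\<^sup>+ y. ennreal (\<rho> x y powr b) \<partial>K x) \<le> (\<integral>\<^sup>+ y. 1 \<partial>K x)"
          using True by (intro nn_integral_mono) simp
        also have "\<dots> = 1"
          by (simp add: prob_space.emeasure_space_1[OF K_prob[OF x]])
        finally show "esqrt (\<integral>\<^sup>+ y. ennreal (\<rho> x y powr b) \<partial>K x) \<le> 1"
          using esqrt_mono[of _ 1] by simp
      qed
      then show ?thesis
        using True by (simp add: P.emeasure_space_1)
    next
      case False
      then have I: "I_bar P Y K \<alpha>' = ereal (1 / b) * elog2 (V\<^sup>2)"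
        by (simp add: I_bar_def V b_def)
      moreover have "\<bar>I_bar P Y K \<alpha>'\<bar> \<noteq> \<infinity>"
        using g False by (simp add: gamma_domain_def b_def)
      ultimately obtain w where w: "0 < w" "V\<^sup>2 = ennreal w" "ib = 1 / b * log 2 w"
        unfolding ib_def using elog2_finiteD[of "1 / b" "V\<^sup>2"] False by auto
      then obtain v where v: "V = ennreal v" "0 \<le> v"
        by (cases V) (auto simp: power2_eq_square ennreal_top_mult)
      then have w': "w = v\<^sup>2"
        using w by (simp add: ennreal_power)
      then have "0 < v"
        using w v by (cases "v = 0") auto
      then have "b * ib / 2 = log 2 v"
        using w w' False by (simp add: log_nat_power)
      then show ?thesis
        using v \<open>0 < v\<close> by simp
    qed
  qed
  define k where "k = 2 * \<alpha> - \<alpha>'"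
  have k: "k = 2 * a + 1 - b" "0 < k"
    using a b by (auto simp: k_def a_def b_def)
  \<comment> \<open>The solution of
    \<open>a * (\<tau> - ic) = (R - b * ib - \<tau> * (1 - b)) / 2\<close>, which equates the tail
    exponent with the variance exponent. The common value is \<open>G\<close>.\<close>
  define \<tau> where "\<tau> = (R - b * ib + 2 * a * ic) / k"
  define G where "G = gamma_term P Y R K \<alpha> \<alpha>'"
  have G: "G = a / k * (R - ic + b * (ic - ib))"
    by (simp add: G_def gamma_term_def ic_def ib_def a_def b_def k_def)
  have \<tau>1: "a * (\<tau> - ic) = G"
    using k(2) unfolding G \<tau>_def by (simp add: field_simps) (simp add: k(1) algebra_simps)
  have \<tau>2: "\<tau> * (1 - b) - R + b * ib = - 2 * G"
    using k(2) unfolding G \<tau>_def by (simp add: field_simps) (simp add: k(1) algebra_simps)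
  let ?\<theta> = "2 powr (real n * \<tau>)"
  have "?B \<le> ennreal (?\<theta> powr (- a)) * U ^ n + ennreal (sqrt (?\<theta> powr (1 - b) / N) / 2) * V ^ n"
    unfolding U_def V_def
    by (rule soft_covering) (use a b codebook_size_pos in auto)
  also have "\<dots> \<le> ennreal (2 powr (- (real n * G))) + ennreal (1 / 2 * 2 powr (- (real n * G)))"
  proof (rule add_mono)
    have "?\<theta> powr (- a) * (2 powr (a * ic)) ^ n = 2 powr (- (real n * (a * (\<tau> - ic))))"
      by (simp add: powr_powr powr_realpow[symmetric] powr_add[symmetric] algebra_simps)
    then show "ennreal (?\<theta> powr (- a)) * U ^ n \<le> ennreal (2 powr (- (real n * G)))"
      by (simp add: U ennreal_power ennreal_mult[symmetric] \<tau>1)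
    \<comment> \<open>The rate enters only here, through the lower bound on the codebook
      size.\<close>
    have "sqrt (?\<theta> powr (1 - b) / N) \<le> sqrt (?\<theta> powr (1 - b) / 2 powr (real n * R))"
      using codebook_size_ge[of n R] codebook_size_pos[of n R]
      by (intro real_sqrt_le_mono divide_left_mono) auto
    also have "\<dots> = 2 powr (real n * (\<tau> * (1 - b) - R) / 2)"
      by (simp add: powr_half_sqrt[symmetric] powr_powr powr_diff[symmetric] algebra_simps
          diff_divide_distrib add_divide_distrib)
    finally have "sqrt (?\<theta> powr (1 - b) / N) / 2 * (2 powr (b * ib / 2)) ^ n
        \<le> 2 powr (real n * (\<tau> * (1 - b) - R) / 2) / 2 * (2 powr (b * ib / 2)) ^ n"
      by (intro mult_right_mono divide_right_mono) auto
    also have "\<dots> = 1 / 2 * 2 powr (real n * (\<tau> * (1 - b) - R + b * ib) / 2)"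
      by (simp add: powr_powr powr_realpow[symmetric] powr_add[symmetric] algebra_simps
          add_divide_distrib diff_divide_distrib)
    also have "\<dots> = 1 / 2 * 2 powr (- (real n * G))"
      unfolding \<tau>2 by simp
    finally have *: "sqrt (?\<theta> powr (1 - b) / N) / 2 * (2 powr (b * ib / 2)) ^ n \<le> 1 / 2 * 2 powr (- (real n * G))" .
    have "ennreal (sqrt (?\<theta> powr (1 - b) / N) / 2) * V ^ n
        \<le> ennreal (sqrt (?\<theta> powr (1 - b) / N) / 2) * ennreal (2 powr (b * ib / 2)) ^ n"
      by (intro mult_left_mono power_mono V) simp_all
    also have "\<dots> = ennreal (sqrt (?\<theta> powr (1 - b) / N) / 2 * (2 powr (b * ib / 2)) ^ n)"
      by (subst ennreal_power, simp, rule ennreal_mult[symmetric]) simp_all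
    finally show "ennreal (sqrt (?\<theta> powr (1 - b) / N) / 2) * V ^ n \<le> ennreal (1 / 2 * 2 powr (- (real n * G)))"
      using ennreal_leI[OF *] by (rule order_trans)
  qed
  also have "\<dots> = ennreal (3 / 2 * 2 powr (- (real n * G)))"
    by (subst ennreal_plus[symmetric]) simp_all
  finally show ?thesis
    by (simp only: G_def)
qed

text \<open>The constant 5/2 is 1 from Chernoff's bound plus 3/2 from soft covering. Each exponent
  is at least the minimum of \<eta> and \<gamma>, so both terms are compared with the same
  exponential.\<close>

lemma expected_excess_prob_bound:
  "expected_excess_prob P Y d R D n K q
    \<le> ennreal (5 / 2) * eexp2 (- (ereal (real n) * min (eta P Y d D K) (gamma P Y R K)))"
proof -
  let ?A = "\<integral>\<^sup>+ y. \<integral>\<^sup>+ x. ennreal (L x y * exceeds x y) \<partial>Pn \<partial>Wn"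
  let ?B = "\<integral>\<^sup>+ x. \<integral>\<^sup>+ c. ennreal (max 0 (1 - (\<Sum>m = 1..N. L x (c m)) / N)) \<partial>C \<partial>Pn"
  let ?E = "eexp2 (- (ereal (real n) * min (eta P Y d D K) (gamma P Y R K)))"
  have mono: "eexp2 (- (ereal (real n) * s)) \<le> ?E" if "min (eta P Y d D K) (gamma P Y R K) \<le> s" for s
    using that by (intro eexp2_mono) (simp add: ereal_mult_left_mono)
  have "?A \<le> (INF \<beta>\<in>{0<..}. \<integral>\<^sup>+ (x, y). ennreal (2 powr (\<beta> * (d x y - D))) \<partial>joint_law P Y K) ^ n"
    using n_pos by (intro le_INF_power chernoff) simp
  also have "\<dots> = eexp2 (- (ereal (real n) * eta P Y d D K))"
    unfolding eta_def by (rule eexp2_neg_elog2_inverse[OF n_pos, symmetric])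
  also have "\<dots> \<le> ?E"
    by (rule mono) simp
  finally have A: "?A \<le> ?E" .
  \<comment> \<open>Scaling by 2/3 removes the prefactor, as \<open>le_eexp2_SUP\<close> expects a
    pure exponential; the factor is restored afterwards.\<close>
  have 32: "ennreal (3 / 2) * (ennreal (2 / 3) * z) = z" "ennreal (2 / 3) * (ennreal (3 / 2) * z) = z" for z
    by (simp_all only: mult.assoc[symmetric] ennreal_mult[symmetric]) simp_all
  have "ennreal (2 / 3) * ?B \<le> ennreal (2 powr (- (real n * case_prod (gamma_term P Y R K) s)))"
    if "s \<in> gamma_domain P Y K" for s
  proof -
    obtain \<alpha> \<alpha>' where s: "s = (\<alpha>, \<alpha>')"
      by (cases s)
    have "ennreal (2 / 3) * ?B \<le> ennreal (2 / 3) * ennreal (3 / 2 * 2 powr (- (real n * gamma_term P Y R K \<alpha> \<alpha>')))"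
      using that unfolding s by (intro mult_left_mono covering_le) simp_all
    also have "\<dots> = ennreal (2 powr (- (real n * gamma_term P Y R K \<alpha> \<alpha>')))"
      by (subst ennreal_mult[symmetric]) simp_all
    finally show ?thesis
      by (simp add: s)
  qed
  then have "ennreal (2 / 3) * ?B
      \<le> eexp2 (- (ereal (real n) * (SUP s\<in>gamma_domain P Y K. ereal (case_prod (gamma_term P Y R K) s))))"
    by (rule le_eexp2_SUP[OF _ n_pos])
  also have "(SUP s\<in>gamma_domain P Y K. ereal (case_prod (gamma_term P Y R K) s)) = gamma P Y R K"
    by (simp add: gamma_def case_prod_unfold)
  also have "eexp2 (- (ereal (real n) * gamma P Y R K)) \<le> ?E"
    by (rule mono) simp
  finally have "ennreal (3 / 2) * (ennreal (2 / 3) * ?B) \<le> ennreal (3 / 2) * ?E"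
    by (rule mult_left_mono) simp
  then have B: "?B \<le> ennreal (3 / 2) * ?E"
    by (simp only: 32)
  have "expected_excess_prob P Y d R D n K q \<le> ?A + ?B"
    by (rule expected_excess_prob_le)
  also have "\<dots> \<le> 1 * ?E + ennreal (3 / 2) * ?E"
    using A B by (intro add_mono) simp_all
  also have "\<dots> = (ennreal 1 + ennreal (3 / 2)) * ?E"
    by (simp only: distrib_right ennreal_1)
  also have "ennreal 1 + ennreal (3 / 2) = ennreal (5 / 2)"
    by (subst ennreal_plus[symmetric]) simp_all
  finally show ?thesis .
qed

end

text \<open>The bound holds for each test channel separately, so the infima compare termwise. The
  fallback \<open>q\<close> may depend on the channel.\<close>

theorem theorem1:
  fixes P :: "'x measure" and Y :: "'y measure"
    and d :: "'x \<Rightarrow> 'y \<Rightarrow> real"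
    and R D :: real and n :: nat
    and q :: "('x \<Rightarrow> 'y measure) \<Rightarrow> nat pmf"
  assumes "prob_space P"
    and "(\<lambda>(x, y). d x y) \<in> borel_measurable (P \<Otimes>\<^sub>M Y)"
    and "\<And>x y. x \<in> space P \<Longrightarrow> y \<in> space Y \<Longrightarrow> 0 \<le> d x y"
    and "rate_distortion P Y d D < ereal R"
    and "0 < n"
    and "\<And>K. K \<in> test_channels P Y d R D \<Longrightarrow> set_pmf (q K) \<subseteq> {1..codebook_size n R}"
  shows "(INF K \<in> test_channels P Y d R D. expected_excess_prob P Y d R D n K (q K))
      \<le> (INF K \<in> test_channels P Y d R D.
            ennreal (5 / 2) * eexp2 (- (ereal (real n) * min (eta P Y d D K) (gamma P Y R K))))"
proof (rule INF_mono)
  fix K assume K: "K \<in> test_channels P Y d R D"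
  \<comment> \<open>Without absolute continuity \<open>mutual_info\<close> is infinite by definition
    and could not be below \<open>R\<close>.\<close>
  have "absolutely_continuous (product_law P Y K) (joint_law P Y K)"
    using K by (auto simp: test_channels_def mutual_info_def split: if_splits)
  with K interpret likelihood_scheme P Y K d R D n "q K"
    using assms
    by (intro likelihood_scheme.intro source_channel.intro source_channel_axioms.intro
        likelihood_scheme_axioms.intro) (auto simp: test_channels_def)
  show "\<exists>K'\<in>test_channels P Y d R D. expected_excess_prob P Y d R D n K' (q K')
      \<le> ennreal (5 / 2) * eexp2 (- (ereal (real n) * min (eta P Y d D K) (gamma P Y R K)))"
    using expected_excess_prob_bound K by blast
qed

end
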